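(* Let $n$ be a positive integer, let $\phi_n\colon PB_n\to\hat G^3_n$ be the homomorphism from the pure braid group on $n$ strands described in the context, and let $\rho\colon \hat G^3_n\to \mathrm{End}_A(V)$ be the representation with $\rho(a_{ijk})=\rho_{ijk}$ described in the context. Then the composition $\rho\circ\phi_n\colon PB_n\to \mathrm{End}_A(V)$ is a representation of the pure braid group $PB_n$ on the free $A$-module $V$.
   Context: Braids. $B_n$ is the braid group with Artin generators $\sigma_1,\dots,\sigma_{n-1}$ and relations $\sigma_i\sigma_j=\sigma_j\sigma_i$ for $|i-j|>1$ and $\sigma_i\sigma_{i+1}\sigma_i=\sigma_{i+1}\sigma_i\sigma_{i+1}$ for $1\le i\le n-2$. Let $\Sigma_n$ be the permutation group of $\{1,\dots,n\}$, and let $\pi\colon B_n\to\Sigma_n$ be the homomorphism with $\pi(\sigma_i)=(i\ \ i+1)$. The pure braid group is $PB_n=\ker\pi$. The group $\hat G^3_n$ has generators $a_{ijk}$, one for each ordered triple of pairwise distinct numbers $i,j,k\in\{1,\dots,n\}$, and the relations: 1. $a_{kji}=a_{ijk}^{-1}$ for all pairwise distinct $i,j,k$; 2. $a_{ijk}a_{pqr}=a_{pqr}a_{ijk}$ whenever there are at least 5 different numbers among $i,j,k,p,q,r$; 3. $a_{ijk}a_{ijl}a_{ikl}a_{jkl}=a_{jkl}a_{ikl}a_{ijl}a_{ijk}$ for all pairwise distinct $i,j,k,l$. Semidirect product. $\tau\in\Sigma_n$ acts on $\hat G^3_n$ by the automorphism $a_{ijk}\mapsto a_{\tau(i)\tau(j)\tau(k)}$.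 The group $\Sigma_n\ltimes\hat G^3_n$ is the set $\Sigma_n\times\hat G^3_n$ with multiplication $(\tau_1,\omega_1)\cdot(\tau_2,\omega_2)=(\tau_1\tau_2,\ \tau_2(\omega_1)\omega_2)$, where the product $\tau_1\tau_2$ in $\Sigma_n$ means first apply $\tau_1$, then $\tau_2$. The map $\phi_n$. $\phi_n\colon B_n\to\Sigma_n\ltimes\hat G^3_n$ denotes the group homomorphism determined by $$\phi_n(\sigma_i)=\bigl(\pi(\sigma_i),\ a_{i-1,i+1,i}\,a_{i-2,i+1,i}\cdots a_{1,i+1,i}\cdot a_{n,i+1,i}\,a_{n-1,i+1,i}\cdots a_{i+2,i+1,i}\bigr),\quad 1\le i\le n-1,$$ where the first index runs down from $i-1$ to $1$ and then down from $n$ to $i+2$ (empty products are $1$). It maps $PB_n$ into the subgroup $1\times\hat G^3_n$, which is identified with $\hat G^3_n$; the resulting homomorphism $PB_n\to\hat G^3_n$ is also denoted $\phi_n$. The representation $\rho$. $A=\mathbb{Z}[t_1^{\pm 1},\dots,t_n^{\pm 1},s_1^{\pm 1},\dots,s_n^{\pm 1}]$ is the Laurent polynomial ring, and $V$ is the free $A$-module with basis $\{x_{ij}\mid i,j\in\{1,\dots,n\},\ i\ne j\}$ (rank $n(n-1)$). The representation $\rho$ of $\hat G^3_n$ on $V$ is given by $\rho(a_{ijk})=\rho_{ijk}$, where $\rho_{ijk}\in\mathrm{End}_A(V)$ is the $A$-linear map with $\rho_{ijk}(x_{ij})=t_ix_{ij}+(1-t_i)x_{ik}$, $\rho_{ijk}(x_{kj})=t_k^{-1}x_{kj}+(1-t_k^{-1})x_{ki}$,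 $\rho_{ijk}(x_{jk})=s_jx_{jk}$, $\rho_{ijk}(x_{ji})=s_j^{-1}x_{ji}$, and $\rho_{ijk}(x_{pq})=x_{pq}$ for all other basis elements. *)

theory Defs
  imports "HOL-Algebra.Sym_Groups" "HOL-Algebra.Module" "HOL-Library.Poly_Mapping"
begin

text \<open>A letter \<open>(x, True)\<close> stands for \<open>x\<close> and \<open>(x, False)\<close> for \<open>x\<close> inverse.
  A relation \<open>l = r\<close> is a pair \<open>(l, r)\<close> of words.\<close>

type_synonym 'g word = "('g \<times> bool) list"

definition words :: "'g set \<Rightarrow> 'g word set"
  where "words A = lists (A \<times> UNIV)"

inductive pres_eq :: "'g set \<Rightarrow> ('g word \<times> 'g word) set \<Rightarrow> 'g word \<Rightarrow> 'g word \<Rightarrow> bool"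
  for A :: "'g set" and R :: "('g word \<times> 'g word) set"
where
  refl: "w \<in> words A \<Longrightarrow> pres_eq A R w w"
| sym: "pres_eq A R v w \<Longrightarrow> pres_eq A R w v"
| trans: "pres_eq A R u v \<Longrightarrow> pres_eq A R v w \<Longrightarrow> pres_eq A R u w"
| cancel: "u \<in> words A \<Longrightarrow> v \<in> words A \<Longrightarrow> x \<in> A \<Longrightarrow>
    pres_eq A R (u @ [(x, b), (x, \<not> b)] @ v) (u @ v)"
| relation: "u \<in> words A \<Longrightarrow> v \<in> words A \<Longrightarrow> l \<in> words A \<Longrightarrow> r \<in> words A \<Longrightarrow> (l, r) \<in> R \<Longrightarrow>
    pres_eq A R (u @ l @ v) (u @ r @ v)"

definition pres_class :: "'g set \<Rightarrow> ('g word \<times> 'g word) set \<Rightarrow> 'g word \<Rightarrow> 'g word set"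
  where "pres_class A R w = {v. pres_eq A R w v}"

definition presented_group :: "'g set \<Rightarrow> ('g word \<times> 'g word) set \<Rightarrow> 'g word set monoid"
  where "presented_group A R =
    \<lparr> carrier = pres_class A R ` words A,
      mult = (\<lambda>C D. \<Union>u\<in>C. \<Union>v\<in>D. pres_class A R (u @ v)),
      one = pres_class A R [] \<rparr>"

definition pres_gen :: "'g set \<Rightarrow> ('g word \<times> 'g word) set \<Rightarrow> 'g \<Rightarrow> 'g word set"
  where "pres_gen A R x = pres_class A R [(x, True)]"

definition eval_word :: "('h, 'm) monoid_scheme \<Rightarrow> ('g \<Rightarrow> 'h) \<Rightarrow> 'g word \<Rightarrow> 'h"
  where "eval_word H f w =
    foldr (\<lambda>(x, b) h. (if b then f x else inv\<^bsub>H\<^esub> f x) \<otimes>\<^bsub>H\<^esub> h) w \<one>\<^bsub>H\<^esub>"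

text \<open>The map on a presented group determined by the images \<open>f x\<close> of the generators. It
  is meaningful only if \<open>f\<close> respects the relations: only then does \<open>eval_word H f\<close> take
  a single value on each class.\<close>

definition induced_map :: "('h, 'm) monoid_scheme \<Rightarrow> ('g \<Rightarrow> 'h) \<Rightarrow> 'g word set \<Rightarrow> 'h"
  where "induced_map H f C = the_elem (eval_word H f ` C)"

definition braid_rels :: "nat \<Rightarrow> (nat word \<times> nat word) set"
  where "braid_rels n =
    {([(i, True), (j, True)], [(j, True), (i, True)]) | i j.
       i \<in> {1..<n} \<and> j \<in> {1..<n} \<and> (i + 1 < j \<or> j + 1 < i)} \<union>
    {([(i, True), (i + 1, True), (i, True)], [(i + 1, True), (i, True), (i + 1, True)]) | i.
       1 \<le> i \<and> i + 2 \<le> n}"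

definition braid_group :: "nat \<Rightarrow> nat word set monoid"
  where "braid_group n = presented_group {1..<n} (braid_rels n)"

definition sigma :: "nat \<Rightarrow> nat \<Rightarrow> nat word set"
  where "sigma n i = pres_gen {1..<n} (braid_rels n) i"

text \<open>The product \<open>p \<otimes> q\<close> of permutations means: first \<open>p\<close>, then \<open>q\<close>. This is opposite to
  \<^const>\<open>sym_group\<close>.\<close>

definition perm_group :: "nat \<Rightarrow> (nat \<Rightarrow> nat) monoid"
  where "perm_group n = (sym_group n) \<lparr> mult := (\<lambda>p q. q \<circ> p) \<rparr>"

definition braid_perm :: "nat \<Rightarrow> nat word set \<Rightarrow> nat \<Rightarrow> nat"
  where "braid_perm n = induced_map (perm_group n) (\<lambda>i. Transposition.transpose i (i + 1))"

definition pure_braid_group :: "nat \<Rightarrow> nat word set monoid"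
  where "pure_braid_group n =
    (braid_group n) \<lparr> carrier := kernel (braid_group n) (perm_group n) (braid_perm n) \<rparr>"

definition triples :: "nat \<Rightarrow> (nat \<times> nat \<times> nat) set"
  where "triples n = {(i, j, k). {i, j, k} \<subseteq> {1..n} \<and> distinct [i, j, k]}"

definition g3_rels :: "nat \<Rightarrow> ((nat \<times> nat \<times> nat) word \<times> (nat \<times> nat \<times> nat) word) set"
  where "g3_rels n =
    {([((k, j, i), True)], [((i, j, k), False)]) | i j k. (i, j, k) \<in> triples n} \<union>
    {([((i, j, k), True), ((p, q, r), True)], [((p, q, r), True), ((i, j, k), True)]) | i j k p q r.
       (i, j, k) \<in> triples n \<and> (p, q, r) \<in> triples n \<and> card {i, j, k, p, q, r} \<ge> 5} \<union>
    {([((i, j, k), True), ((i, j, l), True), ((i, k, l), True), ((j, k, l), True)],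
      [((j, k, l), True), ((i, k, l), True), ((i, j, l), True), ((i, j, k), True)]) | i j k l.
       {i, j, k, l} \<subseteq> {1..n} \<and> distinct [i, j, k, l]}"

definition g3_group :: "nat \<Rightarrow> (nat \<times> nat \<times> nat) word set monoid"
  where "g3_group n = presented_group (triples n) (g3_rels n)"

definition g3_gen :: "nat \<Rightarrow> nat \<Rightarrow> nat \<Rightarrow> nat \<Rightarrow> (nat \<times> nat \<times> nat) word set"
  where "g3_gen n i j k = pres_gen (triples n) (g3_rels n) (i, j, k)"

definition g3_act :: "nat \<Rightarrow> (nat \<Rightarrow> nat) \<Rightarrow>
    (nat \<times> nat \<times> nat) word set \<Rightarrow> (nat \<times> nat \<times> nat) word set"
  where "g3_act n \<tau> = induced_map (g3_group n) (\<lambda>(i, j, k). g3_gen n (\<tau> i) (\<tau> j) (\<tau> k))"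

text \<open>\<open>act\<close> is a right action of \<open>K\<close> on \<open>H\<close>.\<close>

definition semidirect_product ::
    "('k, 'm) monoid_scheme \<Rightarrow> ('h, 'l) monoid_scheme \<Rightarrow> ('k \<Rightarrow> 'h \<Rightarrow> 'h) \<Rightarrow> ('k \<times> 'h) monoid"
  where "semidirect_product K H act =
    \<lparr> carrier = carrier K \<times> carrier H,
      mult = (\<lambda>(k\<^sub>1, h\<^sub>1) (k\<^sub>2, h\<^sub>2). (k\<^sub>1 \<otimes>\<^bsub>K\<^esub> k\<^sub>2, act k\<^sub>2 h\<^sub>1 \<otimes>\<^bsub>H\<^esub> h\<^sub>2)),
      one = (\<one>\<^bsub>K\<^esub>, \<one>\<^bsub>H\<^esub>) \<rparr>"

definition perm_g3_group :: "nat \<Rightarrow> ((nat \<Rightarrow> nat) \<times> (nat \<times> nat \<times> nat) word set) monoid"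
  where "perm_g3_group n = semidirect_product (perm_group n) (g3_group n) (g3_act n)"

definition phi_gen :: "nat \<Rightarrow> nat \<Rightarrow> (nat \<Rightarrow> nat) \<times> (nat \<times> nat \<times> nat) word set"
  where "phi_gen n i =
    (Transposition.transpose i (i + 1),
     foldr (\<lambda>m w. g3_gen n m (i + 1) i \<otimes>\<^bsub>g3_group n\<^esub> w)
       (rev [1..<i] @ rev [i + 2..<n + 1]) \<one>\<^bsub>g3_group n\<^esub>)"

definition phi :: "nat \<Rightarrow> nat word set \<Rightarrow> (nat \<Rightarrow> nat) \<times> (nat \<times> nat \<times> nat) word set"
  where "phi n = induced_map (perm_g3_group n) (phi_gen n)"

text \<open>The restriction to pure braids, where the first component is the identity.\<close>

definition phi_pure :: "nat \<Rightarrow> nat word set \<Rightarrow> (nat \<times> nat \<times> nat) word set"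
  where "phi_pure n b = snd (phi n b)"

definition module_endos :: "('r, 'm) ring_scheme \<Rightarrow> ('r, 'v, 'l) module_scheme \<Rightarrow> ('v \<Rightarrow> 'v) set"
  where "module_endos R M =
    {f \<in> carrier M \<rightarrow>\<^sub>E carrier M.
       (\<forall>v\<in>carrier M. \<forall>w\<in>carrier M. f (v \<oplus>\<^bsub>M\<^esub> w) = f v \<oplus>\<^bsub>M\<^esub> f w) \<and>
       (\<forall>a\<in>carrier R. \<forall>v\<in>carrier M. f (a \<odot>\<^bsub>M\<^esub> v) = a \<odot>\<^bsub>M\<^esub> f v)}"

definition End_monoid :: "('r, 'm) ring_scheme \<Rightarrow> ('r, 'v, 'l) module_scheme \<Rightarrow> ('v \<Rightarrow> 'v) monoid"
  where "End_monoid R M =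
    \<lparr> carrier = module_endos R M,
      mult = (\<lambda>f g. compose (carrier M) f g),
      one = (\<lambda>v\<in>carrier M. v) \<rparr>"

definition representation ::
    "('g, 'k) monoid_scheme \<Rightarrow> ('r, 'm) ring_scheme \<Rightarrow> ('r, 'v, 'l) module_scheme \<Rightarrow>
      ('g \<Rightarrow> 'v \<Rightarrow> 'v) \<Rightarrow> bool"
  where "representation G R M h \<longleftrightarrow>
    module R M \<and> group_hom G (units_of (End_monoid R M)) h"

definition finite_basis ::
    "('r, 'm) ring_scheme \<Rightarrow> ('r, 'v, 'l) module_scheme \<Rightarrow> ('i \<Rightarrow> 'v) \<Rightarrow> 'i set \<Rightarrow> bool"
  where "finite_basis R M x I \<longleftrightarrow>
    finite I \<and> x \<in> I \<rightarrow> carrier M \<and>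
    (\<forall>v\<in>carrier M. \<exists>!c. c \<in> I \<rightarrow>\<^sub>E carrier R \<and> v = (\<Oplus>\<^bsub>M\<^esub>i\<in>I. c i \<odot>\<^bsub>M\<^esub> x i))"

datatype lvar = T nat | S nat

text \<open>A Laurent monomial is a finitely supported map from variables to integer exponents; a
  Laurent polynomial is a finitely supported map from Laurent monomials to integer
  coefficients, with the convolution product of \<^type>\<open>poly_mapping\<close>.\<close>

type_synonym laurent = "(lvar \<Rightarrow>\<^sub>0 int) \<Rightarrow>\<^sub>0 int"

definition lpow :: "lvar \<Rightarrow> int \<Rightarrow> laurent"
  where "lpow x e = Poly_Mapping.single (Poly_Mapping.single x e) 1"

definition laurent_ring :: "nat \<Rightarrow> laurent ring"
  where "laurent_ring n =
    \<lparr> carrier = {p. \<forall>m\<in>Poly_Mapping.keys p. Poly_Mapping.keys m \<subseteq> T ` {1..n} \<union> S ` {1..n}},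
      mult = (*), one = 1, zero = 0, add = (+) \<rparr>"

definition pairs :: "nat \<Rightarrow> (nat \<times> nat) set"
  where "pairs n = {(i, j). i \<in> {1..n} \<and> j \<in> {1..n} \<and> i \<noteq> j}"

text \<open>An element of the free module is the family of its coordinates, extended by zero. The
  multiplicative fields of the module record are not used.\<close>

definition free_mod :: "nat \<Rightarrow> (laurent, nat \<times> nat \<Rightarrow> laurent) module"
  where "free_mod n =
    \<lparr> carrier = {v. (\<forall>b\<in>pairs n. v b \<in> carrier (laurent_ring n)) \<and> (\<forall>b. b \<notin> pairs n \<longrightarrow> v b = 0)},
      mult = undefined, one = undefined,
      zero = (\<lambda>b. 0), add = (\<lambda>v w b. v b + w b), smult = (\<lambda>a v b. a * v b) \<rparr>"

definition basis_vec :: "nat \<times> nat \<Rightarrow> nat \<times> nat \<Rightarrow> laurent"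
  where "basis_vec b = (\<lambda>c. if c = b then 1 else 0)"

definition rho_basis :: "nat \<Rightarrow> nat \<Rightarrow> nat \<Rightarrow> nat \<Rightarrow> nat \<times> nat \<Rightarrow> nat \<times> nat \<Rightarrow> laurent"
  where "rho_basis n i j k b =
    (if b = (i, j) then
       lpow (T i) 1 \<odot>\<^bsub>free_mod n\<^esub> basis_vec (i, j)
         \<oplus>\<^bsub>free_mod n\<^esub> (1 - lpow (T i) 1) \<odot>\<^bsub>free_mod n\<^esub> basis_vec (i, k)
     else if b = (k, j) then
       lpow (T k) (- 1) \<odot>\<^bsub>free_mod n\<^esub> basis_vec (k, j)
         \<oplus>\<^bsub>free_mod n\<^esub> (1 - lpow (T k) (- 1)) \<odot>\<^bsub>free_mod n\<^esub> basis_vec (k, i)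
     else if b = (j, k) then lpow (S j) 1 \<odot>\<^bsub>free_mod n\<^esub> basis_vec (j, k)
     else if b = (j, i) then lpow (S j) (- 1) \<odot>\<^bsub>free_mod n\<^esub> basis_vec (j, i)
     else basis_vec b)"

definition rho_gen :: "nat \<Rightarrow> nat \<Rightarrow> nat \<Rightarrow> nat \<Rightarrow> (nat \<times> nat \<Rightarrow> laurent) \<Rightarrow> nat \<times> nat \<Rightarrow> laurent"
  where "rho_gen n i j k =
    (\<lambda>v\<in>carrier (free_mod n). \<Oplus>\<^bsub>free_mod n\<^esub>b\<in>pairs n. v b \<odot>\<^bsub>free_mod n\<^esub> rho_basis n i j k b)"

definition rho :: "nat \<Rightarrow> (nat \<times> nat \<times> nat) word set \<Rightarrow> (nat \<times> nat \<Rightarrow> laurent) \<Rightarrow> nat \<times> nat \<Rightarrow> laurent"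
  where "rho n =
    induced_map (units_of (End_monoid (laurent_ring n) (free_mod n))) (\<lambda>(i, j, k). rho_gen n i j k)"

end

theory Submission
  imports Defs
begin

text \<open>Every map in question is defined on generators, so each claim reduces to a check of
  relations. For \<open>\<phi>\<^sub>n\<close>, the commutation of \<open>\<sigma>\<^sub>i\<close> and \<open>\<sigma>\<^sub>j\<close> comes down to the tetrahedron relation on
  \<open>(i, i+1, j+1, j)\<close>, and the braid relation to the tetrahedron relations on \<open>(m, i+2, i+1, i)\<close> for the
  remaining strands \<open>m\<close>; all other factors commute because they involve five different indices.
  For \<open>\<rho>\<close>, the relations are identities between the coordinates of a vector.\<close>

section \<open>Presented groups\<close>

text \<open>In the semidirect product the later permutation acts on the earlier second component.
  For distant i < j the transposition of j and j+1 therefore exchanges the two letters of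
  \<phi>(\<open>\<sigma>\<^sub>i\<close>) whose first index is j+1 or j, and the transposition of i
  and i+1 does the same to \<phi>(\<open>\<sigma>\<^sub>j\<close>). Once everything else has
  commuted away, four letters in changed order are left, and that discrepancy is a tetrahedron. The
  cyclic descent of the first index makes the remaining blocks of the two words agree. In the braid
  relation, letters with the triples (i, i+2, i+1) and (i+1, i+2, i) come to stand side by side and
  cancel by reversal; each side keeps three products over the remaining strands and one common
  letter. A second obstacle is well-definedness: \<open>induced_map\<close> is
  \<open>the_elem\<close> of the values on a class, so before the relations are verified not even
  its value on a generator is known. For \<rho>, reversal also gives invertibility: the map of the
  reversed triple is the inverse.\<close>

lemma words_append [simp]: "u @ v \<in> words A \<longleftrightarrow> u \<in> words A \<and> v \<in> words A"
  by (auto simp: words_def)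

lemma words_Cons [simp]: "(x, b) # w \<in> words A \<longleftrightarrow> x \<in> A \<and> w \<in> words A"
  by (auto simp: words_def)

lemma words_Nil [simp]: "[] \<in> words A"
  by (auto simp: words_def)

lemma pres_eq_words: "pres_eq A R v w \<Longrightarrow> v \<in> words A \<and> w \<in> words A"
  by (induction rule: pres_eq.induct) auto

text \<open>The rules \<open>cancel\<close> and \<open>relation\<close> carry a context of their
  own, which absorbs \<open>s\<close> and \<open>t\<close>.\<close>

lemma pres_eq_context:
  assumes "pres_eq A R v w" "s \<in> words A" "t \<in> words A"
  shows "pres_eq A R (s @ v @ t) (s @ w @ t)"
  using assms
proof (induction rule: pres_eq.induct)
  case (cancel u v x b)
  then show ?case
    using pres_eq.cancel[of "s @ u" A "v @ t" x R b] by simp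
next
  case (relation u v l r)
  then show ?case
    using pres_eq.relation[of "s @ u" A "v @ t" l r R] by simp
next
  case (trans u v w)
  then show ?case by (blast intro: pres_eq.trans)
qed (auto intro: pres_eq.refl pres_eq.sym)

lemma pres_eq_append:
  assumes "pres_eq A R u u'" "pres_eq A R v v'"
  shows "pres_eq A R (u @ v) (u' @ v')"
  using pres_eq_context[OF assms(1), of "[]" v] pres_eq_context[OF assms(2), of u' "[]"]
    pres_eq_words[OF assms(1)] pres_eq_words[OF assms(2)]
  by (auto intro: pres_eq.trans)

lemma pres_class_eqI: "pres_eq A R v w \<Longrightarrow> pres_class A R v = pres_class A R w"
  unfolding pres_class_def by (auto intro: pres_eq.trans pres_eq.sym)

lemma pres_class_self: "w \<in> words A \<Longrightarrow> w \<in> pres_class A R w"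
  by (simp add: pres_class_def pres_eq.refl)

lemma presented_group_carrier [simp]:
  "carrier (presented_group A R) = pres_class A R ` words A"
  by (simp add: presented_group_def)

lemma presented_group_one [simp]: "\<one>\<^bsub>presented_group A R\<^esub> = pres_class A R []"
  by (simp add: presented_group_def)

text \<open>The product is a union over all pairs of representatives. Concatenation respects the
  congruence, so all members of the union are one and the same class, and it is not an empty union
  because each class contains its own word.\<close>

lemma presented_group_mult [simp]:
  assumes "u \<in> words A" "v \<in> words A"
  shows "pres_class A R u \<otimes>\<^bsub>presented_group A R\<^esub> pres_class A R v = pres_class A R (u @ v)"
proof -
  have const: "pres_class A R (u' @ v') = pres_class A R (u @ v)"
    if "u' \<in> pres_class A R u" "v' \<in> pres_class A R v" for u' v'
    using that pres_class_eqI[OF pres_eq_append[of A R u u' v v']] by (simp add: pres_class_def)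
  then have "(\<Union>u'\<in>pres_class A R u. \<Union>v'\<in>pres_class A R v. pres_class A R (u' @ v')) =
      (\<Union>u'\<in>pres_class A R u. \<Union>v'\<in>pres_class A R v. pres_class A R (u @ v))"
    by (intro SUP_cong HOL.refl const)
  also have "\<dots> = pres_class A R (u @ v)"
    using pres_class_self[OF assms(1), of R] pres_class_self[OF assms(2), of R] by blast
  finally show ?thesis by (simp add: presented_group_def)
qed

definition inv_word :: "'g word \<Rightarrow> 'g word"
  where "inv_word w = rev (map (\<lambda>(x, b). (x, \<not> b)) w)"

lemma inv_word_words: "w \<in> words A \<Longrightarrow> inv_word w \<in> words A"
  by (auto simp: inv_word_def words_def)

lemma inv_word_left: "w \<in> words A \<Longrightarrow> pres_eq A R (inv_word w @ w) []"
proof (induction w)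
  case Nil
  then show ?case by (simp add: inv_word_def pres_eq.refl)
next
  case (Cons a w)
  obtain x b where a: "a = (x, b)" by (cases a)
  have w: "w \<in> words A" "x \<in> A" using Cons.prems by (auto simp: a)
  \<comment> \<open>The new letter meets its inverse in the middle of the word; the double negation
    gives this pair the shape required by \<open>cancel\<close>.\<close>
  have "pres_eq A R (inv_word w @ [(x, \<not> b), (x, \<not> \<not> b)] @ w) (inv_word w @ w)"
    using w by (intro pres_eq.cancel inv_word_words)
  then show ?case
    using Cons.IH[OF w(1)] by (auto simp: a inv_word_def intro: pres_eq.trans)
qed

lemma group_presented_group [simp, intro]: "group (presented_group A R)"
proof (rule groupI)
  fix X Y assume "X \<in> carrier (presented_group A R)" "Y \<in> carrier (presented_group A R)"
  then obtain u v where "u \<in> words A" "X = pres_class A R u" "v \<in> words A" "Y = pres_class A R v"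
    by auto
  then show "X \<otimes>\<^bsub>presented_group A R\<^esub> Y \<in> carrier (presented_group A R)"
    by simp
next
  fix X assume "X \<in> carrier (presented_group A R)"
  then obtain w where w: "w \<in> words A" "X = pres_class A R w" by auto
  have "pres_class A R (inv_word w) \<otimes>\<^bsub>presented_group A R\<^esub> X = \<one>\<^bsub>presented_group A R\<^esub>"
    using w inv_word_words[OF w(1)] pres_class_eqI[OF inv_word_left[OF w(1)]] by simp
  then show "\<exists>Y\<in>carrier (presented_group A R).
      Y \<otimes>\<^bsub>presented_group A R\<^esub> X = \<one>\<^bsub>presented_group A R\<^esub>"
    using inv_word_words[OF w(1)] by auto
next
  fix X Y Z assume "X \<in> carrier (presented_group A R)" "Y \<in> carrier (presented_group A R)"
    "Z \<in> carrier (presented_group A R)"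
  then obtain u v w where "u \<in> words A" "X = pres_class A R u" "v \<in> words A" "Y = pres_class A R v"
    "w \<in> words A" "Z = pres_class A R w"
    by auto
  then show "X \<otimes>\<^bsub>presented_group A R\<^esub> Y \<otimes>\<^bsub>presented_group A R\<^esub> Z =
      X \<otimes>\<^bsub>presented_group A R\<^esub> (Y \<otimes>\<^bsub>presented_group A R\<^esub> Z)"
    by simp
next
  fix X assume "X \<in> carrier (presented_group A R)"
  then obtain w where "w \<in> words A" "X = pres_class A R w" by auto
  then show "\<one>\<^bsub>presented_group A R\<^esub> \<otimes>\<^bsub>presented_group A R\<^esub> X = X" by simp
next
  show "\<one>\<^bsub>presented_group A R\<^esub> \<in> carrier (presented_group A R)"
    unfolding presented_group_one presented_group_carrier by (intro imageI words_Nil)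
qed

lemma pres_gen_closed: "x \<in> A \<Longrightarrow> pres_gen A R x \<in> carrier (presented_group A R)"
  by (auto simp: pres_gen_def)

text \<open>Links the sign of a letter to inversion in the group, so that a class can be evaluated
  letter by letter.\<close>

lemma pres_class_letter:
  assumes "x \<in> A"
  shows "pres_class A R [(x, b)] =
    (if b then pres_gen A R x else inv\<^bsub>presented_group A R\<^esub> pres_gen A R x)"
proof -
  interpret group "presented_group A R" by simp
  have "pres_class A R [(x, False)] \<otimes>\<^bsub>presented_group A R\<^esub> pres_gen A R x =
      \<one>\<^bsub>presented_group A R\<^esub>"
    using assms pres_class_eqI[OF pres_eq.cancel[of "[]" A "[]" x R False]]
    by (simp add: pres_gen_def)
  then show ?thesis
    using assms inv_equality[of "pres_class A R [(x, False)]" "pres_gen A R x"]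
      pres_gen_closed[OF assms, of R]
    by (auto simp: pres_gen_def)
qed

section \<open>Evaluation of words in a group and homomorphisms out of a presented group\<close>

lemma eval_word_Nil [simp]: "eval_word H f [] = \<one>\<^bsub>H\<^esub>"
  by (simp add: eval_word_def)

lemma eval_word_Cons [simp]:
  "eval_word H f ((x, b) # w) = (if b then f x else inv\<^bsub>H\<^esub> f x) \<otimes>\<^bsub>H\<^esub> eval_word H f w"
  by (simp add: eval_word_def)

context group
begin

lemma eval_word_closed:
  assumes "f \<in> A \<rightarrow> carrier G" "w \<in> words A"
  shows "eval_word G f w \<in> carrier G"
  using assms(2)
proof (induction w)
  case (Cons a w)
  obtain x b where a: "a = (x, b)" by (cases a)
  then have "f x \<in> carrier G" using Cons.prems assms(1) by auto
  then show ?case using Cons by (simp add: a)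
qed simp

lemma eval_word_append:
  assumes "f \<in> A \<rightarrow> carrier G" "u \<in> words A" "v \<in> words A"
  shows "eval_word G f (u @ v) = eval_word G f u \<otimes> eval_word G f v"
  using assms(2)
proof (induction u)
  case (Cons a u)
  obtain x b where a: "a = (x, b)" by (cases a)
  then have "f x \<in> carrier G" using Cons.prems assms(1) by auto
  then show ?case
    using Cons assms(3) by (simp add: a m_assoc eval_word_closed[OF assms(1)])
qed (simp add: eval_word_closed[OF assms(1,3)])

text \<open>The restriction to relations between words over \<open>A\<close> mirrors the rule
  \<open>relation\<close> of \<open>pres_eq\<close>, which admits only such pairs.\<close>

definition satisfies :: "('g \<Rightarrow> 'a) \<Rightarrow> 'g set \<Rightarrow> ('g word \<times> 'g word) set \<Rightarrow> bool"
  where "satisfies f A R \<longleftrightarrow> f \<in> A \<rightarrow> carrier G \<and>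
    (\<forall>(l, r)\<in>R. l \<in> words A \<longrightarrow> r \<in> words A \<longrightarrow> eval_word G f l = eval_word G f r)"

lemma eval_word_pres_eq:
  assumes "satisfies f A R" "pres_eq A R v w"
  shows "eval_word G f v = eval_word G f w"
proof -
  have f: "f \<in> A \<rightarrow> carrier G" using assms(1) by (simp add: satisfies_def)
  note [simp] = eval_word_append[OF f]
  note closed = eval_word_closed[OF f]
  from assms(2) show ?thesis
  proof (induction rule: pres_eq.induct)
    case (cancel u v x b)
    then have "f x \<in> carrier G" using f by auto
    then show ?case
      using cancel closed by (cases b) (simp_all flip: m_assoc)
  next
    case (relation u v l r)
    then show ?case using assms(1) by (auto simp: satisfies_def)
  qed auto
qed

text \<open>Evaluation is constant on a class and the class is nonempty, so its image is a singleton
  and \<open>the_elem\<close> returns the intended value.\<close>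

lemma induced_map_pres_class:
  assumes "satisfies f A R" "w \<in> words A"
  shows "induced_map G f (pres_class A R w) = eval_word G f w"
proof -
  have "eval_word G f ` pres_class A R w = {eval_word G f w}"
  proof
    show "eval_word G f ` pres_class A R w \<subseteq> {eval_word G f w}"
    proof (intro image_subsetI)
      fix v assume "v \<in> pres_class A R w"
      then have "pres_eq A R w v" by (simp add: pres_class_def)
      from eval_word_pres_eq[OF assms(1) this]
      show "eval_word G f v \<in> {eval_word G f w}" by simp
    qed
    show "{eval_word G f w} \<subseteq> eval_word G f ` pres_class A R w"
      using pres_class_self[OF assms(2), of R] by blast
  qed
  then show ?thesis by (simp add: induced_map_def)
qed

text \<open>Von Dyck's theorem. Every homomorphism below that is defined on generators is obtained
  from it.\<close>

lemma group_hom_induced_map: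
  assumes "satisfies f A R"
  shows "group_hom (presented_group A R) G (induced_map G f)"
proof -
  have f: "f \<in> A \<rightarrow> carrier G" using assms by (simp add: satisfies_def)
  have "induced_map G f \<in> hom (presented_group A R) G"
  proof (rule homI)
    fix X assume "X \<in> carrier (presented_group A R)"
    then obtain u where "u \<in> words A" "X = pres_class A R u" by auto
    then show "induced_map G f X \<in> carrier G"
      by (simp add: induced_map_pres_class[OF assms] eval_word_closed[OF f])
  next
    fix X Y assume "X \<in> carrier (presented_group A R)" "Y \<in> carrier (presented_group A R)"
    then obtain u v where "u \<in> words A" "X = pres_class A R u" "v \<in> words A" "Y = pres_class A R v"
      by auto
    then show "induced_map G f (X \<otimes>\<^bsub>presented_group A R\<^esub> Y) =
        induced_map G f X \<otimes> induced_map G f Y"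
      by (simp add: induced_map_pres_class[OF assms] eval_word_append[OF f])
  qed
  then show ?thesis
    by (simp add: group_hom_def group_hom_axioms_def group_axioms)
qed

lemma induced_map_pres_gen:
  assumes "satisfies f A R" "x \<in> A"
  shows "induced_map G f (pres_gen A R x) = f x"
proof -
  have "f x \<in> carrier G" using assms by (auto simp: satisfies_def)
  then show ?thesis
    using assms(2) induced_map_pres_class[OF assms(1)] by (simp add: pres_gen_def)
qed

end

text \<open>A class is a product of classes of single letters, so induction on a representing word
  suffices. This yields the laws of the permutation action and the first component of \<phi> without
  any computation on words.\<close>

lemma group_hom_pres_eqI:
  assumes g: "group_hom (presented_group A R) H g" and h: "group_hom (presented_group A R) H h"
    and gens: "\<And>x. x \<in> A \<Longrightarrow> g (pres_gen A R x) = h (pres_gen A R x)"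
    and "X \<in> carrier (presented_group A R)"
  shows "g X = h X"
proof -
  let ?P = "presented_group A R"
  interpret g: group_hom ?P H g by (fact g)
  interpret h: group_hom ?P H h by (fact h)
  have "g (pres_class A R w) = h (pres_class A R w)" if "w \<in> words A" for w
    using that
  proof (induction w)
    case Nil
    then show ?case using g.hom_one h.hom_one by simp
  next
    case (Cons a w)
    obtain x b where a: "a = (x, b)" by (cases a)
    have w: "w \<in> words A" "x \<in> A" using Cons.prems by (auto simp: a)
    have letter: "g (pres_class A R [(x, b)]) = h (pres_class A R [(x, b)])"
      using gens[OF w(2)] pres_gen_closed[OF w(2), of R]
      by (auto simp: pres_class_letter[OF w(2)] simp del: presented_group_carrier)
    have "pres_class A R (a # w) = pres_class A R [(x, b)] \<otimes>\<^bsub>?P\<^esub> pres_class A R w"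
      using w by (simp add: a)
    then show ?case
      using Cons.IH w letter g.hom_mult[of "pres_class A R [(x, b)]" "pres_class A R w"]
        h.hom_mult[of "pres_class A R [(x, b)]" "pres_class A R w"] by simp
  qed
  then show ?thesis using assms(4) by auto
qed

lemma pres_class_relation:
  "(l, r) \<in> R \<Longrightarrow> l \<in> words A \<Longrightarrow> r \<in> words A \<Longrightarrow> pres_class A R l = pres_class A R r"
  using pres_class_eqI[OF pres_eq.relation[of "[]" A "[]" l r R]] by simp

text \<open>With this tautological evaluation, simplifying \<open>eval_word\<close> on an explicit
  pair of words turns a relation into an equation between products of generators.\<close>

lemma eval_word_pres_gen:
  "w \<in> words A \<Longrightarrow> eval_word (presented_group A R) (pres_gen A R) w = pres_class A R w"
proof (induction w)
  case (Cons a w)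
  obtain x b where a: "a = (x, b)" by (cases a)
  have w: "w \<in> words A" "x \<in> A" using Cons.prems by (auto simp: a)
  have "eval_word (presented_group A R) (pres_gen A R) (a # w) =
      pres_class A R [(x, b)] \<otimes>\<^bsub>presented_group A R\<^esub> pres_class A R w"
    unfolding a pres_class_letter[OF w(2)] by (simp add: Cons.IH[OF w(1)])
  then show ?case using w by (simp add: a)
qed simp

lemma eval_word_relation:
  assumes "(l, r) \<in> R" "l \<in> words A" "r \<in> words A"
  shows "eval_word (presented_group A R) (pres_gen A R) l =
    eval_word (presented_group A R) (pres_gen A R) r"
  using assms by (simp add: eval_word_pres_gen pres_class_relation)

section \<open>Semidirect products\<close>

lemma semidirect_product_simps [simp]:
  "carrier (semidirect_product K H act) = carrier K \<times> carrier H"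
  "\<one>\<^bsub>semidirect_product K H act\<^esub> = (\<one>\<^bsub>K\<^esub>, \<one>\<^bsub>H\<^esub>)"
  "(k, h) \<otimes>\<^bsub>semidirect_product K H act\<^esub> (k', h') = (k \<otimes>\<^bsub>K\<^esub> k', act k' h \<otimes>\<^bsub>H\<^esub> h')"
  by (simp_all add: semidirect_product_def)

lemma group_semidirect_product:
  assumes "group K" "group H"
    and hom: "\<And>k. k \<in> carrier K \<Longrightarrow> act k \<in> hom H H"
    and one: "\<And>h. h \<in> carrier H \<Longrightarrow> act \<one>\<^bsub>K\<^esub> h = h"
    and mult: "\<And>k k' h. k \<in> carrier K \<Longrightarrow> k' \<in> carrier K \<Longrightarrow> h \<in> carrier H \<Longrightarrow>
      act (k \<otimes>\<^bsub>K\<^esub> k') h = act k' (act k h)"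
  shows "group (semidirect_product K H act)"
proof -
  interpret K: group K by fact
  interpret H: group H by fact
  have closed: "act k h \<in> carrier H" if "k \<in> carrier K" "h \<in> carrier H" for k h
    using hom[OF that(1)] that(2) by (rule hom_in_carrier)
  have act_mult: "act k (h \<otimes>\<^bsub>H\<^esub> h') = act k h \<otimes>\<^bsub>H\<^esub> act k h'"
    if "k \<in> carrier K" "h \<in> carrier H" "h' \<in> carrier H" for k h h'
    using hom_mult[OF hom[OF that(1)] that(2,3)] .
  have act_one: "act k \<one>\<^bsub>H\<^esub> = \<one>\<^bsub>H\<^esub>" if "k \<in> carrier K" for k
    using hom_one[OF hom[OF that] assms(2,2)] .
  show ?thesis
  proof (rule groupI)
    fix x assume "x \<in> carrier (semidirect_product K H act)"
    then obtain k h where x: "x = (k, h)" "k \<in> carrier K" "h \<in> carrier H" by auto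
    \<comment> \<open>The second component is forced: acting on it by \<open>k\<close> gives the
      inverse of \<open>h\<close>, because \<open>act k\<close> undoes the action of the inverse of
      \<open>k\<close>.\<close>
    let ?y = "(inv\<^bsub>K\<^esub> k, act (inv\<^bsub>K\<^esub> k) (inv\<^bsub>H\<^esub> h))"
    have "?y \<otimes>\<^bsub>semidirect_product K H act\<^esub> x = \<one>\<^bsub>semidirect_product K H act\<^esub>"
      using x by (simp add: one flip: mult)
    moreover have "?y \<in> carrier (semidirect_product K H act)"
      using x closed by simp
    ultimately show "\<exists>y\<in>carrier (semidirect_product K H act).
        y \<otimes>\<^bsub>semidirect_product K H act\<^esub> x = \<one>\<^bsub>semidirect_product K H act\<^esub>" by blast
  qed (auto simp: closed act_mult act_one mult K.m_assoc H.m_assoc)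
qed

lemma group_hom_fst_semidirect_product:
  assumes "group K" "group (semidirect_product K H act)"
  shows "group_hom (semidirect_product K H act) K fst"
  using assms by (auto simp: group_hom_def group_hom_axioms_def hom_def)

section \<open>Permutations multiplied from left to right, and the relations behind the permutation
  of a braid\<close>

lemma perm_group_simps [simp]:
  "carrier (perm_group n) = {p. p permutes {1..n}}"
  "p \<otimes>\<^bsub>perm_group n\<^esub> q = q \<circ> p"
  "\<one>\<^bsub>perm_group n\<^esub> = id"
  by (simp_all add: perm_group_def sym_group_def)

lemma group_perm_group [simp, intro]: "group (perm_group n)"
proof (rule groupI)
  fix p assume "p \<in> carrier (perm_group n)"
  then show "\<exists>q\<in>carrier (perm_group n). q \<otimes>\<^bsub>perm_group n\<^esub> p = \<one>\<^bsub>perm_group n\<^esub>"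
    by (intro bexI[of _ "inv' p"]) (auto simp: permutes_inv permutes_inv_o(1))
qed (auto simp: permutes_compose permutes_id comp_assoc)

lemma transpose_permutes: "1 \<le> i \<Longrightarrow> i < n \<Longrightarrow> Transposition.transpose i (Suc i) permutes {1..n}"
  by (intro permutes_swap_id) auto

lemma satisfies_braid_perm:
  "group.satisfies (perm_group n) (\<lambda>i. Transposition.transpose i (i + 1)) {1..<n} (braid_rels n)"
proof -
  interpret group "perm_group n" by simp
  show ?thesis
    unfolding satisfies_def braid_rels_def
    by (auto simp: transpose_permutes[simplified] fun_eq_iff Transposition.transpose_def)
qed

section \<open>Ordered products\<close>

context group
begin

text \<open>The same fold as in \<open>phi_gen\<close>, so the second component of \<phi> on a
  generator is such a product.\<close>

definition mprod :: "('i \<Rightarrow> 'a) \<Rightarrow> 'i list \<Rightarrow> 'a"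
  where "mprod f ms = foldr (\<lambda>m w. f m \<otimes> w) ms \<one>"

lemma mprod_simps [simp]:
  "mprod f [] = \<one>"
  "mprod f (m # ms) = f m \<otimes> mprod f ms"
  by (simp_all add: mprod_def)

lemma mprod_closed: "(\<And>m. m \<in> set ms \<Longrightarrow> f m \<in> carrier G) \<Longrightarrow> mprod f ms \<in> carrier G"
  by (induction ms) auto

lemma mprod_append:
  assumes "\<And>m. m \<in> set (ms @ ms') \<Longrightarrow> f m \<in> carrier G"
  shows "mprod f (ms @ ms') = mprod f ms \<otimes> mprod f ms'"
  using assms by (induction ms) (auto simp: m_assoc mprod_closed)

lemma mprod_cong: "(\<And>m. m \<in> set ms \<Longrightarrow> f m = g m) \<Longrightarrow> mprod f ms = mprod g ms"
  by (induction ms) auto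

text \<open>Moves a commuting pair in front of the rest of a right-nested product. Instantiated with
  single commutations, it becomes a family of rewrite rules whose orientation fixes the target order
  of the factors.\<close>

lemma m_left_commute:
  assumes "x \<otimes> y = y \<otimes> x" "x \<in> carrier G" "y \<in> carrier G" "z \<in> carrier G"
  shows "x \<otimes> (y \<otimes> z) = y \<otimes> (x \<otimes> z)"
  using assms by (metis m_assoc)

lemma mprod_commute_elem:
  assumes "x \<in> carrier G" "\<And>m. m \<in> set ms \<Longrightarrow> f m \<in> carrier G"
    "\<And>m. m \<in> set ms \<Longrightarrow> f m \<otimes> x = x \<otimes> f m"
  shows "mprod f ms \<otimes> x = x \<otimes> mprod f ms"
  using assms(2,3)
proof (induction ms)
  case (Cons m ms)
  then have "f m \<in> carrier G" "mprod f ms \<in> carrier G" "mprod f ms \<otimes> x = x \<otimes> mprod f ms"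
    "f m \<otimes> x = x \<otimes> f m"
    by (auto intro: mprod_closed)
  then show ?case
    using assms(1) by (simp add: m_assoc m_left_commute)
qed (use assms(1) in simp)

lemma mprod_commute:
  assumes "\<And>m. m \<in> set ms \<Longrightarrow> f m \<in> carrier G" "\<And>m. m \<in> set ms' \<Longrightarrow> g m \<in> carrier G"
    "\<And>m m'. m \<in> set ms \<Longrightarrow> m' \<in> set ms' \<Longrightarrow> f m \<otimes> g m' = g m' \<otimes> f m"
  shows "mprod f ms \<otimes> mprod g ms' = mprod g ms' \<otimes> mprod f ms"
  by (rule mprod_commute_elem) (auto simp: assms mprod_closed mprod_commute_elem)

text \<open>Factors with different indices commute, so the three products can be sorted by index,
  with the triple of the head in front. The induction hypothesis moves \<open>x\<close> past the
  triples of the tail and reverses them; the relation for the head does the same with its own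
  triple, after which the sorting is undone.\<close>

lemma mprod_hexagon:
  assumes closed: "x \<in> carrier G"
      "\<And>m. m \<in> set ms \<Longrightarrow> f m \<in> carrier G \<and> g m \<in> carrier G \<and> h m \<in> carrier G"
    and hexagon: "\<And>m. m \<in> set ms \<Longrightarrow>
      f m \<otimes> (g m \<otimes> (h m \<otimes> x)) = x \<otimes> (h m \<otimes> (g m \<otimes> f m))"
    and commute: "\<And>m m'. m \<in> set ms \<Longrightarrow> m' \<in> set ms \<Longrightarrow> m \<noteq> m' \<Longrightarrow>
      f m \<otimes> g m' = g m' \<otimes> f m \<and> f m \<otimes> h m' = h m' \<otimes> f m \<and> g m \<otimes> h m' = h m' \<otimes> g m"
    and "distinct ms"
  shows "mprod f ms \<otimes> (mprod g ms \<otimes> (mprod h ms \<otimes> x)) =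
    x \<otimes> (mprod h ms \<otimes> (mprod g ms \<otimes> mprod f ms))"
  using assms(2-)
proof (induction ms)
  case Nil
  then show ?case using closed(1) by simp
next
  case (Cons m ms)
  define F G' H where "F = mprod f ms" and "G' = mprod g ms" and "H = mprod h ms"
  have cl: "f m \<in> carrier G" "g m \<in> carrier G" "h m \<in> carrier G"
    "F \<in> carrier G" "G' \<in> carrier G" "H \<in> carrier G"
    using Cons.prems(1) by (auto simp: F_def G'_def H_def intro!: mprod_closed)
  have comm: "F \<otimes> g m = g m \<otimes> F" "F \<otimes> h m = h m \<otimes> F" "G' \<otimes> h m = h m \<otimes> G'"
      "G' \<otimes> f m = f m \<otimes> G'" "H \<otimes> f m = f m \<otimes> H" "H \<otimes> g m = g m \<otimes> H"
    unfolding F_def G'_def H_def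
    using Cons.prems(1,3,4) by (intro mprod_commute_elem; force)+
  note left_comm = comm[THEN m_left_commute]
  have IH: "F \<otimes> (G' \<otimes> (H \<otimes> x)) = x \<otimes> (H \<otimes> (G' \<otimes> F))"
    unfolding F_def G'_def H_def using Cons.prems by (intro Cons.IH) auto
  \<comment> \<open>The relation of the head with a tail \<open>z\<close>, so that it can rewrite
    inside a right-nested product.\<close>
  have hex: "f m \<otimes> (g m \<otimes> (h m \<otimes> (x \<otimes> z))) = x \<otimes> (h m \<otimes> (g m \<otimes> (f m \<otimes> z)))"
    if "z \<in> carrier G" for z
  proof -
    have "(f m \<otimes> (g m \<otimes> (h m \<otimes> x))) \<otimes> z = (x \<otimes> (h m \<otimes> (g m \<otimes> f m))) \<otimes> z"
      using Cons.prems(2)[of m] by simp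
    then show ?thesis using that cl closed(1) by (simp add: m_assoc)
  qed
  show ?case
    using cl closed(1)
    by (simp add: m_assoc left_comm comm IH hex flip: F_def G'_def H_def)
qed

text \<open>The second components of \<open>\<phi>(\<sigma>\<^sub>i\<sigma>\<^sub>j)\<close> and \<open>\<phi>(\<sigma>\<^sub>j\<sigma>\<^sub>i)\<close> for distant \<open>i\<close> and \<open>j\<close>: only
  \<open>X, Y\<close> and \<open>Z, W\<close> involve both transposed pairs of indices.\<close>

lemma far_commute:
  assumes cl: "A \<in> carrier G" "B \<in> carrier G" "C \<in> carrier G" "D \<in> carrier G"
      "X \<in> carrier G" "Y \<in> carrier G" "Z \<in> carrier G" "W \<in> carrier G"
    and A: "C \<otimes> A = A \<otimes> C" "D \<otimes> A = A \<otimes> D" "Z \<otimes> A = A \<otimes> Z" "W \<otimes> A = A \<otimes> W"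
    and B: "B \<otimes> C = C \<otimes> B" "B \<otimes> D = D \<otimes> B" "B \<otimes> Z = Z \<otimes> B" "B \<otimes> W = W \<otimes> B"
    and C: "X \<otimes> C = C \<otimes> X" "Y \<otimes> C = C \<otimes> Y"
    and D: "D \<otimes> X = X \<otimes> D" "D \<otimes> Y = Y \<otimes> D"
    and tetra: "Y \<otimes> (X \<otimes> (Z \<otimes> W)) = W \<otimes> (Z \<otimes> (X \<otimes> Y))"
  shows "A \<otimes> (Y \<otimes> (X \<otimes> B)) \<otimes> (C \<otimes> (Z \<otimes> (W \<otimes> D))) =
    C \<otimes> (W \<otimes> (Z \<otimes> D)) \<otimes> (A \<otimes> (X \<otimes> (Y \<otimes> B)))"
proof -
  note left_comm = A[THEN m_left_commute] B[THEN m_left_commute] C[THEN m_left_commute]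
    D[THEN m_left_commute]
  have tetra': "Y \<otimes> (X \<otimes> (Z \<otimes> (W \<otimes> z))) = W \<otimes> (Z \<otimes> (X \<otimes> (Y \<otimes> z)))"
    if "z \<in> carrier G" for z
  proof -
    have "(Y \<otimes> (X \<otimes> (Z \<otimes> W))) \<otimes> z = (W \<otimes> (Z \<otimes> (X \<otimes> Y))) \<otimes> z"
      using tetra by simp
    then show ?thesis using that cl by (simp add: m_assoc)
  qed
  \<comment> \<open>Both sides are rewritten to the order \<open>A\<close>, \<open>C\<close>,
    \<open>W\<close>, \<open>Z\<close>, \<open>X\<close>, \<open>Y\<close>, \<open>D\<close>,
    \<open>B\<close>. The commutation of \<open>B\<close> and \<open>D\<close> is needed at the very
    end of the product, where no tail follows, hence the plain \<open>B(2)\<close>.\<close>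
  show ?thesis
    using cl by (simp add: m_assoc left_comm B(2) tetra')
qed

end

lemma (in group_hom) hom_mprod:
  assumes "\<And>m. m \<in> set ms \<Longrightarrow> f m \<in> carrier G"
  shows "h (group.mprod G f ms) = group.mprod H (\<lambda>m. h (f m)) ms"
  using assms by (induction ms) (auto simp: G.mprod_closed)

section \<open>The group of triples\<close>

lemma g3_gen_closed: "(i, j, k) \<in> triples n \<Longrightarrow> g3_gen n i j k \<in> carrier (g3_group n)"
  unfolding g3_gen_def g3_group_def by (rule pres_gen_closed)

lemma group_g3_group [simp, intro]: "group (g3_group n)"
  unfolding g3_group_def by (rule group_presented_group)

lemma g3_relation:
  assumes "(l, r) \<in> g3_rels n" "l \<in> words (triples n)" "r \<in> words (triples n)"
  shows "eval_word (g3_group n) (\<lambda>(i, j, k). g3_gen n i j k) l =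
    eval_word (g3_group n) (\<lambda>(i, j, k). g3_gen n i j k) r"
  using eval_word_relation[OF assms]
  by (simp add: g3_group_def g3_gen_def[abs_def] case_prod_unfold)

lemma triples_iff: "(i, j, k) \<in> triples n \<longleftrightarrow>
    i \<in> {1..n} \<and> j \<in> {1..n} \<and> k \<in> {1..n} \<and> i \<noteq> j \<and> i \<noteq> k \<and> j \<noteq> k"
  by (auto simp: triples_def)

lemma g3_inv:
  assumes "(i, j, k) \<in> triples n"
  shows "g3_gen n k j i = inv\<^bsub>g3_group n\<^esub> g3_gen n i j k"
proof -
  interpret group "g3_group n" by simp
  have kji: "(k, j, i) \<in> triples n" using assms by (auto simp: triples_iff)
  have "([((k, j, i), True)], [((i, j, k), False)]) \<in> g3_rels n"
    using assms unfolding g3_rels_def by blast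
  from g3_relation[OF this] show ?thesis
    using assms kji g3_gen_closed[OF assms] g3_gen_closed[OF kji] by simp
qed

lemma g3_commute:
  assumes "(i, j, k) \<in> triples n" "(p, q, r) \<in> triples n" "card {i, j, k, p, q, r} \<ge> 5"
  shows "g3_gen n i j k \<otimes>\<^bsub>g3_group n\<^esub> g3_gen n p q r = g3_gen n p q r \<otimes>\<^bsub>g3_group n\<^esub> g3_gen n i j k"
proof -
  interpret group "g3_group n" by simp
  have "([((i, j, k), True), ((p, q, r), True)], [((p, q, r), True), ((i, j, k), True)]) \<in> g3_rels n"
    using assms unfolding g3_rels_def by blast
  from g3_relation[OF this] show ?thesis
    using assms(1,2) g3_gen_closed[OF assms(1)] g3_gen_closed[OF assms(2)] by simp
qed

lemma g3_tetrahedron: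
  assumes "{i, j, k, l} \<subseteq> {1..n}" "distinct [i, j, k, l]"
  shows "g3_gen n i j k \<otimes>\<^bsub>g3_group n\<^esub> (g3_gen n i j l \<otimes>\<^bsub>g3_group n\<^esub>
      (g3_gen n i k l \<otimes>\<^bsub>g3_group n\<^esub> g3_gen n j k l)) =
    g3_gen n j k l \<otimes>\<^bsub>g3_group n\<^esub> (g3_gen n i k l \<otimes>\<^bsub>g3_group n\<^esub>
      (g3_gen n i j l \<otimes>\<^bsub>g3_group n\<^esub> g3_gen n i j k))"
proof -
  interpret group "g3_group n" by simp
  have t: "(i, j, k) \<in> triples n" "(i, j, l) \<in> triples n" "(i, k, l) \<in> triples n"
    "(j, k, l) \<in> triples n"
    using assms by (auto simp: triples_iff)
  have "([((i, j, k), True), ((i, j, l), True), ((i, k, l), True), ((j, k, l), True)],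
      [((j, k, l), True), ((i, k, l), True), ((i, j, l), True), ((i, j, k), True)]) \<in> g3_rels n"
    using assms unfolding g3_rels_def by blast
  from g3_relation[OF this] show ?thesis
    using t t[THEN g3_gen_closed] by simp
qed

text \<open>The three families of relations as equations in \<open>H\<close>, nested to the right as
  evaluation leaves them. This serves two targets: the group of triples itself, for the permutation
  action, and the units of the endomorphism monoid, for \<rho>.\<close>

lemma satisfies_g3I:
  assumes "group H"
    and "\<And>i j k. (i, j, k) \<in> triples n \<Longrightarrow> f i j k \<in> carrier H"
    and "\<And>i j k. (i, j, k) \<in> triples n \<Longrightarrow> f k j i = inv\<^bsub>H\<^esub> f i j k"
    and "\<And>i j k p q r. (i, j, k) \<in> triples n \<Longrightarrow> (p, q, r) \<in> triples n \<Longrightarrow>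
      card {i, j, k, p, q, r} \<ge> 5 \<Longrightarrow> f i j k \<otimes>\<^bsub>H\<^esub> f p q r = f p q r \<otimes>\<^bsub>H\<^esub> f i j k"
    and "\<And>i j k l. {i, j, k, l} \<subseteq> {1..n} \<Longrightarrow> distinct [i, j, k, l] \<Longrightarrow>
      f i j k \<otimes>\<^bsub>H\<^esub> (f i j l \<otimes>\<^bsub>H\<^esub> (f i k l \<otimes>\<^bsub>H\<^esub> f j k l)) =
      f j k l \<otimes>\<^bsub>H\<^esub> (f i k l \<otimes>\<^bsub>H\<^esub> (f i j l \<otimes>\<^bsub>H\<^esub> f i j k))"
  shows "group.satisfies H (\<lambda>(i, j, k). f i j k) (triples n) (g3_rels n)"
proof -
  interpret group H by fact
  let ?f = "\<lambda>(i, j, k). f i j k"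
  have eval: "eval_word H ?f l = eval_word H ?f r"
    if lr: "(l, r) \<in> g3_rels n" "l \<in> words (triples n)" "r \<in> words (triples n)" for l r
  proof -
    consider (inv) i j k where "l = [((k, j, i), True)]" "r = [((i, j, k), False)]"
        "(i, j, k) \<in> triples n"
      | (commute) i j k p q s where "l = [((i, j, k), True), ((p, q, s), True)]"
        "r = [((p, q, s), True), ((i, j, k), True)]" "(i, j, k) \<in> triples n"
        "(p, q, s) \<in> triples n" "card {i, j, k, p, q, s} \<ge> 5"
      | (tetra) i j k m where
        "l = [((i, j, k), True), ((i, j, m), True), ((i, k, m), True), ((j, k, m), True)]"
        "r = [((j, k, m), True), ((i, k, m), True), ((i, j, m), True), ((i, j, k), True)]"
        "{i, j, k, m} \<subseteq> {1..n}" "distinct [i, j, k, m]"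
      using lr(1) unfolding g3_rels_def Un_iff mem_Collect_eq prod.inject
      by (elim disjE exE conjE) (rule that; assumption)+
    then show ?thesis
    proof cases
      case inv
      show ?thesis
        using assms(2)[OF inv(3)] assms(3)[OF inv(3)] by (simp add: inv(1,2))
    next
      case commute
      show ?thesis
        using assms(2)[OF commute(3)] assms(2)[OF commute(4)] assms(4)[OF commute(3-5)]
        by (simp add: commute(1,2))
    next
      case tetra
      have "f i j k \<in> carrier H" "f i j m \<in> carrier H" "f i k m \<in> carrier H"
        "f j k m \<in> carrier H"
        using lr(2) tetra(1) by (simp_all add: assms(2))
      then show ?thesis using assms(5)[OF tetra(3,4)] by (simp add: tetra(1,2))
    qed
  qed
  have "?f \<in> triples n \<rightarrow> carrier H" using assms(2) by auto
  with eval show ?thesis unfolding satisfies_def by blast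
qed

section \<open>The action of permutations on the group of triples\<close>

lemma triples_permutes:
  assumes "\<tau> permutes {1..n}" "(i, j, k) \<in> triples n"
  shows "(\<tau> i, \<tau> j, \<tau> k) \<in> triples n"
  using assms(2) permutes_in_image[OF assms(1)] permutes_inj[OF assms(1)]
  by (auto simp: triples_iff inj_eq simp del: atLeastAtMost_iff)

text \<open>An injective relabelling keeps indices distinct and preserves how many different ones
  occur, so it carries each relation to a relation of the same family.\<close>

lemma satisfies_g3_act:
  assumes "\<tau> permutes {1..n}"
  shows "group.satisfies (g3_group n) (\<lambda>(i, j, k). g3_gen n (\<tau> i) (\<tau> j) (\<tau> k)) (triples n) (g3_rels n)"
proof (rule satisfies_g3I)
  note inj = permutes_inj[OF assms]
  fix i j k p q r
  assume t: "(i, j, k) \<in> triples n" "(p, q, r) \<in> triples n" "5 \<le> card {i, j, k, p, q, r}"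
  have "card (\<tau> ` {i, j, k, p, q, r}) = card {i, j, k, p, q, r}"
    by (rule card_image) (meson inj inj_on_subset subset_UNIV)
  then show "g3_gen n (\<tau> i) (\<tau> j) (\<tau> k) \<otimes>\<^bsub>g3_group n\<^esub> g3_gen n (\<tau> p) (\<tau> q) (\<tau> r) =
      g3_gen n (\<tau> p) (\<tau> q) (\<tau> r) \<otimes>\<^bsub>g3_group n\<^esub> g3_gen n (\<tau> i) (\<tau> j) (\<tau> k)"
    using t by (intro g3_commute triples_permutes[OF assms]) auto
next
  fix i j k l assume t: "{i, j, k, l} \<subseteq> {1..n}" "distinct [i, j, k, l]"
  have "{\<tau> i, \<tau> j, \<tau> k, \<tau> l} \<subseteq> {1..n}" "distinct [\<tau> i, \<tau> j, \<tau> k, \<tau> l]"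
    using t permutes_in_image[OF assms] permutes_inj[OF assms]
    by (auto simp: inj_eq simp del: atLeastAtMost_iff)
  from g3_tetrahedron[OF this] show "g3_gen n (\<tau> i) (\<tau> j) (\<tau> k) \<otimes>\<^bsub>g3_group n\<^esub>
      (g3_gen n (\<tau> i) (\<tau> j) (\<tau> l) \<otimes>\<^bsub>g3_group n\<^esub>
        (g3_gen n (\<tau> i) (\<tau> k) (\<tau> l) \<otimes>\<^bsub>g3_group n\<^esub> g3_gen n (\<tau> j) (\<tau> k) (\<tau> l))) =
    g3_gen n (\<tau> j) (\<tau> k) (\<tau> l) \<otimes>\<^bsub>g3_group n\<^esub>
      (g3_gen n (\<tau> i) (\<tau> k) (\<tau> l) \<otimes>\<^bsub>g3_group n\<^esub>
        (g3_gen n (\<tau> i) (\<tau> j) (\<tau> l) \<otimes>\<^bsub>g3_group n\<^esub> g3_gen n (\<tau> i) (\<tau> j) (\<tau> k)))" .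
qed (auto simp: triples_permutes[OF assms] intro!: g3_gen_closed g3_inv)

lemma group_hom_g3_act:
  "\<tau> permutes {1..n} \<Longrightarrow> group_hom (g3_group n) (g3_group n) (g3_act n \<tau>)"
  using group.group_hom_induced_map[OF group_g3_group satisfies_g3_act]
  unfolding g3_act_def g3_group_def by blast

lemma g3_act_gen:
  "\<tau> permutes {1..n} \<Longrightarrow> (i, j, k) \<in> triples n \<Longrightarrow>
    g3_act n \<tau> (g3_gen n i j k) = g3_gen n (\<tau> i) (\<tau> j) (\<tau> k)"
  using group.induced_map_pres_gen[OF group_g3_group satisfies_g3_act, of \<tau> n "(i, j, k)"]
  unfolding g3_act_def by (simp add: g3_gen_def)

lemma g3_hom_eqI:
  assumes "group_hom (g3_group n) H g" "group_hom (g3_group n) H h"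
    "\<And>i j k. (i, j, k) \<in> triples n \<Longrightarrow> g (g3_gen n i j k) = h (g3_gen n i j k)"
    "X \<in> carrier (g3_group n)"
  shows "g X = h X"
  by (rule group_hom_pres_eqI[OF assms(1,2)[unfolded g3_group_def]])
    (use assms(3,4) in \<open>auto simp: g3_gen_def g3_group_def\<close>)

lemma group_hom_id: "group G \<Longrightarrow> group_hom G G (\<lambda>x. x)"
  by (simp add: group_hom_def group_hom_axioms_def hom_def)

lemma group_hom_comp:
  assumes "group_hom G H g" "group_hom H K h"
  shows "group_hom G K (\<lambda>x. h (g x))"
  using assms hom_compose[of g G H h K]
  by (auto simp: group_hom_def group_hom_axioms_def o_def)

lemma g3_act_id:
  assumes "X \<in> carrier (g3_group n)"
  shows "g3_act n id X = X"
  by (rule g3_hom_eqI[OF group_hom_g3_act[OF permutes_id] group_hom_id _ assms])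
    (simp_all add: g3_act_gen[OF permutes_id])

text \<open>Both sides are homomorphisms that agree on generators. Since the product in
  \<open>perm_group\<close> is composition in the opposite order, this is the right-action law
  required by \<open>group_semidirect_product\<close>.\<close>

lemma g3_act_comp:
  assumes "\<tau> permutes {1..n}" "\<sigma> permutes {1..n}" "X \<in> carrier (g3_group n)"
  shows "g3_act n (\<sigma> \<circ> \<tau>) X = g3_act n \<sigma> (g3_act n \<tau> X)"
proof -
  have comp: "\<sigma> \<circ> \<tau> permutes {1..n}" using permutes_compose[OF assms(1,2)] .
  show ?thesis
    by (rule g3_hom_eqI[OF group_hom_g3_act[OF comp]
          group_hom_comp[OF group_hom_g3_act[OF assms(1)] group_hom_g3_act[OF assms(2)]] _ assms(3)])
      (simp add: g3_act_gen[OF comp] g3_act_gen[OF assms(1)] g3_act_gen[OF assms(2)]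
        triples_permutes[OF assms(1)])
qed

text \<open>By the action laws, the inverse permutation acts as a two-sided inverse.\<close>

lemma g3_act_iso:
  assumes "\<tau> permutes {1..n}"
  shows "g3_act n \<tau> \<in> iso (g3_group n) (g3_group n)"
proof -
  interpret f: group_hom "g3_group n" "g3_group n" "g3_act n \<tau>"
    using group_hom_g3_act[OF assms] .
  have inv: "inv' \<tau> permutes {1..n}" using permutes_inv[OF assms] .
  interpret g: group_hom "g3_group n" "g3_group n" "g3_act n (inv' \<tau>)"
    using group_hom_g3_act[OF inv] .
  have "bij_betw (g3_act n \<tau>) (carrier (g3_group n)) (carrier (g3_group n))"
  proof (rule bij_betw_byWitness[where f' = "g3_act n (inv' \<tau>)"])
    show "\<forall>X\<in>carrier (g3_group n). g3_act n (inv' \<tau>) (g3_act n \<tau> X) = X"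
      using g3_act_comp[OF assms inv] g3_act_id permutes_inv_o(2)[OF assms] by metis
    show "\<forall>X\<in>carrier (g3_group n). g3_act n \<tau> (g3_act n (inv' \<tau>) X) = X"
      using g3_act_comp[OF inv assms] g3_act_id permutes_inv_o(1)[OF assms] by metis
  qed auto
  then show ?thesis by (simp add: iso_def f.homh)
qed

lemma group_perm_g3_group [simp, intro]: "group (perm_g3_group n)"
  unfolding perm_g3_group_def
  by (rule group_semidirect_product)
    (auto simp: g3_act_id g3_act_comp group_hom.homh[OF group_hom_g3_act])

section \<open>The homomorphism from the braid group\<close>

lemma phi_gen_eq:
  "phi_gen n i = (Transposition.transpose i (Suc i),
    group.mprod (g3_group n) (\<lambda>m. g3_gen n m (Suc i) i) (rev [1..<i] @ rev [i + 2..<n + 1]))"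
  by (simp add: phi_gen_def group.mprod_def[OF group_g3_group])

lemma g3_act_mprod:
  assumes "\<tau> permutes {1..n}" "\<And>m. m \<in> set ms \<Longrightarrow> (m, p, q) \<in> triples n"
  shows "g3_act n \<tau> (group.mprod (g3_group n) (\<lambda>m. g3_gen n m p q) ms) =
    group.mprod (g3_group n) (\<lambda>m. g3_gen n (\<tau> m) (\<tau> p) (\<tau> q)) ms"
proof -
  interpret group_hom "g3_group n" "g3_group n" "g3_act n \<tau>"
    using group_hom_g3_act[OF assms(1)] .
  have closed: "g3_gen n m p q \<in> carrier (g3_group n)" if "m \<in> set ms" for m
    using assms(2)[OF that] by (rule g3_gen_closed)
  have "g3_act n \<tau> (G.mprod (\<lambda>m. g3_gen n m p q) ms) =
      G.mprod (\<lambda>m. g3_act n \<tau> (g3_gen n m p q)) ms"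
    by (rule hom_mprod) (rule closed)
  also have "\<dots> = G.mprod (\<lambda>m. g3_gen n (\<tau> m) (\<tau> p) (\<tau> q)) ms"
    by (rule G.mprod_cong) (rule g3_act_gen[OF assms])
  finally show ?thesis .
qed

text \<open>The six indices may coincide in various ways, so the cardinality is bounded from below
  by exhibiting five distinct ones.\<close>

lemma g3_commute_distinct:
  assumes "(i, j, k) \<in> triples n" "(p, q, r) \<in> triples n"
    "distinct xs" "length xs = 5" "set xs \<subseteq> {i, j, k, p, q, r}"
  shows "g3_gen n i j k \<otimes>\<^bsub>g3_group n\<^esub> g3_gen n p q r = g3_gen n p q r \<otimes>\<^bsub>g3_group n\<^esub> g3_gen n i j k"
proof (rule g3_commute[OF assms(1,2)])
  have "card (set xs) = 5" using assms(3,4) by (simp add: distinct_card)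
  then show "5 \<le> card {i, j, k, p, q, r}"
    using card_mono[OF _ assms(5)] by simp
qed

text \<open>Here \<open>m'\<close> may equal \<open>m\<close>, \<open>p\<close> or \<open>q\<close>:
  the other five indices are already different. So a letter whose first index avoids both transposed
  pairs commutes with every letter of the other word.\<close>

lemma g3_commute_outer:
  assumes "{m, p, q, m', r, s} \<subseteq> {1..n}" "distinct [m, p, q, r, s]" "m' \<noteq> r" "m' \<noteq> s"
  shows "g3_gen n m p q \<otimes>\<^bsub>g3_group n\<^esub> g3_gen n m' r s = g3_gen n m' r s \<otimes>\<^bsub>g3_group n\<^esub> g3_gen n m p q"
  by (rule g3_commute_distinct[OF _ _ assms(2)]) (use assms in \<open>auto simp: triples_iff\<close>)

lemma upt_append: "i \<le> j \<Longrightarrow> j \<le> k \<Longrightarrow> [i..<j] @ [j..<k] = [i..<k]"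
  using upt_add_eq_append[of i j "k - j"] by simp

lemma phi_gen_closed:
  assumes "1 \<le> i" "i < n"
  shows "phi_gen n i \<in> carrier (perm_g3_group n)"
proof -
  interpret G: group "g3_group n" by simp
  have "G.mprod (\<lambda>m. g3_gen n m (Suc i) i) (rev [1..<i] @ rev [i + 2..<n + 1]) \<in> carrier (g3_group n)"
    using assms by (intro G.mprod_closed g3_gen_closed) (auto simp: triples_iff)
  then show ?thesis
    using transpose_permutes[OF assms] by (simp add: phi_gen_eq perm_g3_group_def)
qed

text \<open>In cyclic descending order the first indices read \<open>Q\<close>, j+1, j,
  \<open>R\<close> around i and \<open>R\<close>, i+1, i, \<open>Q\<close> around j, with the same
  blocks \<open>Q\<close> and \<open>R\<close>. Acting by the other transposition fixes the products
  over the blocks and swaps the two letters between them (\<open>X\<close> with \<open>Y\<close>,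
  \<open>Z\<close> with \<open>W\<close>), so \<open>far_commute\<close> leaves only the equation
  \<open>tetra\<close> between four letters.\<close>

lemma phi_gen_far:
  assumes "1 \<le> i" "i + 1 < j" "j < n"
  shows "phi_gen n i \<otimes>\<^bsub>perm_g3_group n\<^esub> phi_gen n j = phi_gen n j \<otimes>\<^bsub>perm_g3_group n\<^esub> phi_gen n i"
proof -
  let ?G = "g3_group n"
  interpret G: group ?G by simp
  let ?a = "g3_gen n"
  define i' j' where "i' = Suc i" and "j' = Suc j"
  let ?t = "Transposition.transpose i i'" and ?u = "Transposition.transpose j j'"
  define Q R where "Q = rev [1..<i] @ rev [j + 2..<n + 1]" and "R = rev [i + 2..<j]"
  note closed = G.mprod_closed g3_gen_closed
  have perm: "?t permutes {1..n}" "?u permutes {1..n}"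
    using assms unfolding i'_def j'_def by (intro transpose_permutes; simp)+
  have *: "[i + 2..<n + 1] = [i + 2..<j] @ j # j' # [j + 2..<n + 1]"
    using assms upt_append[of "i + 2" j "n + 1"] by (simp add: upt_conv_Cons i'_def j'_def del: upt_Suc)
  have **: "[1..<j] = [1..<i] @ i # i' # [i + 2..<j]"
    using assms upt_append[of 1 i j] by (simp add: upt_conv_Cons i'_def j'_def del: upt_Suc)
  have listi: "rev [1..<i] @ rev [i + 2..<n + 1] = Q @ [j', j] @ R"
    unfolding * Q_def R_def by (simp del: upt_Suc)
  have listj: "rev [1..<j] @ rev [j + 2..<n + 1] = R @ [i', i] @ Q"
    unfolding ** Q_def R_def by (simp del: upt_Suc)
  have Q: "m \<in> {1..n} \<and> m \<noteq> i \<and> m \<noteq> i' \<and> m \<noteq> j \<and> m \<noteq> j'" if "m \<in> set Q" for m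
    using that assms by (auto simp: Q_def i'_def j'_def)
  have R: "m \<in> {1..n} \<and> m \<noteq> i \<and> m \<noteq> i' \<and> m \<noteq> j \<and> m \<noteq> j'" if "m \<in> set R" for m
    using that assms by (auto simp: R_def i'_def j'_def)
  have ij: "i \<in> {1..n}" "i' \<in> {1..n}" "j \<in> {1..n}" "j' \<in> {1..n}" "j \<noteq> i" "j \<noteq> i'"
    "j' \<noteq> i" "j' \<noteq> i'" "i \<noteq> i'" "j \<noteq> j'"
    using assms by (auto simp: i'_def j'_def)
  define A B C D where "A = G.mprod (\<lambda>m. ?a m i' i) Q" and "B = G.mprod (\<lambda>m. ?a m i' i) R"
    and "C = G.mprod (\<lambda>m. ?a m j' j) R" and "D = G.mprod (\<lambda>m. ?a m j' j) Q"
  define X Y Z W where "X = ?a j' i' i" and "Y = ?a j i' i"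
    and "Z = ?a i' j' j" and "W = ?a i j' j"
  note defs = A_def B_def C_def D_def X_def Y_def Z_def W_def
  have cl: "A \<in> carrier ?G" "B \<in> carrier ?G" "C \<in> carrier ?G" "D \<in> carrier ?G"
    "X \<in> carrier ?G" "Y \<in> carrier ?G" "Z \<in> carrier ?G" "W \<in> carrier ?G"
    unfolding defs using Q R ij by (auto intro!: closed simp: triples_iff)
  have comm1: "?a m i' i \<otimes>\<^bsub>?G\<^esub> ?a m' j' j = ?a m' j' j \<otimes>\<^bsub>?G\<^esub> ?a m i' i"
    if "m \<in> {1..n} \<and> m \<noteq> i \<and> m \<noteq> i' \<and> m \<noteq> j \<and> m \<noteq> j'" "m' \<in> {1..n}" "m' \<noteq> j" "m' \<noteq> j'"
    for m m'
    by (rule g3_commute_outer) (use that ij in simp_all)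
  have comm2: "?a m' j' j \<otimes>\<^bsub>?G\<^esub> ?a m i' i = ?a m i' i \<otimes>\<^bsub>?G\<^esub> ?a m' j' j"
    if "m' \<in> {1..n} \<and> m' \<noteq> i \<and> m' \<noteq> i' \<and> m' \<noteq> j \<and> m' \<noteq> j'" "m \<in> {1..n}" "m \<noteq> i" "m \<noteq> i'"
    for m m'
    by (rule g3_commute_outer) (use that ij in simp_all)
  have mprods: "G.mprod (\<lambda>m. ?a m i' i) ms \<otimes>\<^bsub>?G\<^esub> G.mprod (\<lambda>m. ?a m j' j) ms' =
      G.mprod (\<lambda>m. ?a m j' j) ms' \<otimes>\<^bsub>?G\<^esub> G.mprod (\<lambda>m. ?a m i' i) ms"
    if "set ms \<subseteq> set Q \<union> set R" "set ms' \<subseteq> set Q \<union> set R" for ms ms'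
    using that Q R ij by (intro G.mprod_commute comm1 g3_gen_closed) (auto simp: triples_iff)
  have QR: "m \<in> {1..n} \<and> m \<noteq> i \<and> m \<noteq> i' \<and> m \<noteq> j \<and> m \<noteq> j'"
    "?a m i' i \<in> carrier ?G" "?a m j' j \<in> carrier ?G"
    if "m \<in> set ms" "set ms \<subseteq> set Q \<union> set R" for m ms
  proof -
    show m: "m \<in> {1..n} \<and> m \<noteq> i \<and> m \<noteq> i' \<and> m \<noteq> j \<and> m \<noteq> j'"
      using that Q R by blast
    show "?a m i' i \<in> carrier ?G" "?a m j' j \<in> carrier ?G"
      using m ij by (intro g3_gen_closed; simp add: triples_iff)+
  qed
  have elem1: "G.mprod (\<lambda>m. ?a m i' i) ms \<otimes>\<^bsub>?G\<^esub> ?a m' j' j =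
      ?a m' j' j \<otimes>\<^bsub>?G\<^esub> G.mprod (\<lambda>m. ?a m i' i) ms"
    if ms: "set ms \<subseteq> set Q \<union> set R" and m': "m' \<in> {1..n}" "m' \<noteq> j" "m' \<noteq> j'" for ms m'
  proof (rule G.mprod_commute_elem)
    show "?a m' j' j \<in> carrier ?G"
      using m' ij by (intro g3_gen_closed) (simp add: triples_iff)
  next
    fix m assume m: "m \<in> set ms"
    show "?a m i' i \<in> carrier ?G" by (rule QR(2)[OF m ms])
    show "?a m i' i \<otimes>\<^bsub>?G\<^esub> ?a m' j' j = ?a m' j' j \<otimes>\<^bsub>?G\<^esub> ?a m i' i"
      by (rule comm1[OF QR(1)[OF m ms] m'])
  qed
  have elem2: "G.mprod (\<lambda>m. ?a m j' j) ms \<otimes>\<^bsub>?G\<^esub> ?a m' i' i =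
      ?a m' i' i \<otimes>\<^bsub>?G\<^esub> G.mprod (\<lambda>m. ?a m j' j) ms"
    if ms: "set ms \<subseteq> set Q \<union> set R" and m': "m' \<in> {1..n}" "m' \<noteq> i" "m' \<noteq> i'" for ms m'
  proof (rule G.mprod_commute_elem)
    show "?a m' i' i \<in> carrier ?G"
      using m' ij by (intro g3_gen_closed) (simp add: triples_iff)
  next
    fix m assume m: "m \<in> set ms"
    show "?a m j' j \<in> carrier ?G" by (rule QR(3)[OF m ms])
    show "?a m j' j \<otimes>\<^bsub>?G\<^esub> ?a m' i' i = ?a m' i' i \<otimes>\<^bsub>?G\<^esub> ?a m j' j"
      by (rule comm2[OF QR(1)[OF m ms] m'])
  qed
  have tetra: "Y \<otimes>\<^bsub>?G\<^esub> (X \<otimes>\<^bsub>?G\<^esub> (Z \<otimes>\<^bsub>?G\<^esub> W)) = W \<otimes>\<^bsub>?G\<^esub> (Z \<otimes>\<^bsub>?G\<^esub> (X \<otimes>\<^bsub>?G\<^esub> Y))"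
  proof -
    have tr: "(j', i', i) \<in> triples n" "(j, i', i) \<in> triples n"
      using ij by (auto simp: triples_iff)
    \<comment> \<open>In the relation on \<open>(i, i', j', j)\<close> the first two generators are
      the reversals of \<open>X\<close> and \<open>Y\<close>, hence their inverses; the last two are
      \<open>W\<close> and \<open>Z\<close>.\<close>
    have *: "inv\<^bsub>?G\<^esub> X \<otimes>\<^bsub>?G\<^esub> (inv\<^bsub>?G\<^esub> Y \<otimes>\<^bsub>?G\<^esub> (W \<otimes>\<^bsub>?G\<^esub> Z)) =
        Z \<otimes>\<^bsub>?G\<^esub> (W \<otimes>\<^bsub>?G\<^esub> (inv\<^bsub>?G\<^esub> Y \<otimes>\<^bsub>?G\<^esub> inv\<^bsub>?G\<^esub> X))"
      using g3_tetrahedron[of i "i'" "j'" j n] ij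
      by (simp add: defs g3_inv[OF tr(1)] g3_inv[OF tr(2)])
    \<comment> \<open>Multiplication by \<open>Y\<close>, \<open>X\<close> on the left and by
      \<open>X\<close>, \<open>Y\<close> on the right removes the inverses.\<close>
    have "Y \<otimes>\<^bsub>?G\<^esub> (X \<otimes>\<^bsub>?G\<^esub> (Z \<otimes>\<^bsub>?G\<^esub> W)) =
        Y \<otimes>\<^bsub>?G\<^esub> (X \<otimes>\<^bsub>?G\<^esub> (Z \<otimes>\<^bsub>?G\<^esub> (W \<otimes>\<^bsub>?G\<^esub> (inv\<^bsub>?G\<^esub> Y \<otimes>\<^bsub>?G\<^esub> inv\<^bsub>?G\<^esub> X)))) \<otimes>\<^bsub>?G\<^esub> (X \<otimes>\<^bsub>?G\<^esub> Y)"
      using cl by (simp add: G.m_assoc G.inv_solve_left' flip: G.m_assoc[of "inv\<^bsub>?G\<^esub> X" X Y])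
    also have "\<dots> = W \<otimes>\<^bsub>?G\<^esub> (Z \<otimes>\<^bsub>?G\<^esub> (X \<otimes>\<^bsub>?G\<^esub> Y))"
      using cl by (simp add: G.m_assoc flip: * G.m_assoc[of X "inv\<^bsub>?G\<^esub> X"] G.m_assoc[of Y "inv\<^bsub>?G\<^esub> Y"])
    finally show ?thesis .
  qed
  have main: "A \<otimes>\<^bsub>?G\<^esub> (Y \<otimes>\<^bsub>?G\<^esub> (X \<otimes>\<^bsub>?G\<^esub> B)) \<otimes>\<^bsub>?G\<^esub> (C \<otimes>\<^bsub>?G\<^esub> (Z \<otimes>\<^bsub>?G\<^esub> (W \<otimes>\<^bsub>?G\<^esub> D))) =
      C \<otimes>\<^bsub>?G\<^esub> (W \<otimes>\<^bsub>?G\<^esub> (Z \<otimes>\<^bsub>?G\<^esub> D)) \<otimes>\<^bsub>?G\<^esub> (A \<otimes>\<^bsub>?G\<^esub> (X \<otimes>\<^bsub>?G\<^esub> (Y \<otimes>\<^bsub>?G\<^esub> B)))"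
    \<comment> \<open>Of the twelve open commutations, four are between two blocks and eight between
      a block and a letter.\<close>
    by (rule G.far_commute[OF cl _ _ _ _ _ _ _ _ _ _ _ _ tetra];
        (unfold defs)?; (rule mprods mprods[symmetric] elem1 elem1[symmetric] elem2 elem2[symmetric]; use ij in force))
  have \<omega>i: "phi_gen n i = (?t, A \<otimes>\<^bsub>?G\<^esub> (X \<otimes>\<^bsub>?G\<^esub> (Y \<otimes>\<^bsub>?G\<^esub> B)))"
    unfolding phi_gen_eq listi defs i'_def[symmetric] using Q R ij
    by (subst G.mprod_append) (auto intro!: closed simp: triples_iff)
  have \<omega>j: "phi_gen n j = (?u, C \<otimes>\<^bsub>?G\<^esub> (Z \<otimes>\<^bsub>?G\<^esub> (W \<otimes>\<^bsub>?G\<^esub> D)))"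
    unfolding phi_gen_eq listj defs j'_def[symmetric] using Q R ij
    by (subst G.mprod_append) (auto intro!: closed simp: triples_iff)
  have act: "g3_act n \<tau> (a \<otimes>\<^bsub>?G\<^esub> (b \<otimes>\<^bsub>?G\<^esub> (c \<otimes>\<^bsub>?G\<^esub> d))) =
      g3_act n \<tau> a \<otimes>\<^bsub>?G\<^esub> (g3_act n \<tau> b \<otimes>\<^bsub>?G\<^esub> (g3_act n \<tau> c \<otimes>\<^bsub>?G\<^esub> g3_act n \<tau> d))"
    if "\<tau> permutes {1..n}" "a \<in> carrier ?G" "b \<in> carrier ?G" "c \<in> carrier ?G" "d \<in> carrier ?G"
    for \<tau> a b c d
    using that by (simp add: group_hom.hom_mult[OF group_hom_g3_act])
  have ui: "g3_act n ?u (G.mprod (\<lambda>m. ?a m i' i) ms) = G.mprod (\<lambda>m. ?a m i' i) ms"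
    if "set ms \<subseteq> set Q \<union> set R" for ms
  proof (subst g3_act_mprod[OF perm(2)])
    show "G.mprod (\<lambda>m. ?a (?u m) (?u i') (?u i)) ms = G.mprod (\<lambda>m. ?a m i' i) ms"
      using that Q R ij by (intro G.mprod_cong) (auto simp: Transposition.transpose_def)
  qed (use that Q R ij in \<open>auto simp: triples_iff\<close>)
  have tj: "g3_act n ?t (G.mprod (\<lambda>m. ?a m j' j) ms) = G.mprod (\<lambda>m. ?a m j' j) ms"
    if "set ms \<subseteq> set Q \<union> set R" for ms
  proof (subst g3_act_mprod[OF perm(1)])
    show "G.mprod (\<lambda>m. ?a (?t m) (?t j') (?t j)) ms = G.mprod (\<lambda>m. ?a m j' j) ms"
      using that Q R ij by (intro G.mprod_cong) (auto simp: Transposition.transpose_def)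
  qed (use that Q R ij in \<open>auto simp: triples_iff\<close>)
  have "g3_act n ?u A = A" "g3_act n ?u B = B" "g3_act n ?t C = C" "g3_act n ?t D = D"
    unfolding defs by (rule ui tj; simp)+
  moreover have "g3_act n ?u X = Y" "g3_act n ?u Y = X" "g3_act n ?t Z = W" "g3_act n ?t W = Z"
    unfolding defs using ij
    by (simp_all add: g3_act_gen[OF perm(1)] g3_act_gen[OF perm(2)] triples_iff Transposition.transpose_def)
  moreover have "?u \<circ> ?t = ?t \<circ> ?u"
    using ij by (auto simp: fun_eq_iff Transposition.transpose_def)
  ultimately show ?thesis
    using main
    by (simp add: \<omega>i \<omega>j perm_g3_group_def act[OF perm(2) cl(1,5,6,2)] act[OF perm(1) cl(3,7,8,4)])
qed

text \<open>After the actions have been carried out, the left side is \<open>f k j\<close>,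
  \<open>?a i k j\<close>, \<open>?a j k i\<close>, \<open>f k i\<close>, \<open>f j i\<close>,
  \<open>?a k j i\<close> and the right side is \<open>?a k j i\<close>, \<open>f j i\<close>,
  \<open>f k i\<close>, \<open>?a j k i\<close>, \<open>?a i k j\<close>, \<open>f k j\<close>. The
  adjacent letters \<open>?a i k j\<close> and \<open>?a j k i\<close> are inverse to each other,
  and what is left is an instance of \<open>mprod_hexagon\<close> with \<open>x\<close> equal to
  \<open>?a k j i\<close>.\<close>

lemma phi_gen_braid:
  assumes "1 \<le> i" "i + 2 \<le> n"
  shows "phi_gen n i \<otimes>\<^bsub>perm_g3_group n\<^esub> (phi_gen n (i + 1) \<otimes>\<^bsub>perm_g3_group n\<^esub> phi_gen n i) =
    phi_gen n (i + 1) \<otimes>\<^bsub>perm_g3_group n\<^esub> (phi_gen n i \<otimes>\<^bsub>perm_g3_group n\<^esub> phi_gen n (i + 1))"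
proof -
  let ?G = "g3_group n"
  interpret G: group ?G by simp
  let ?a = "g3_gen n"
  define j k where "j = Suc i" and "k = Suc j"
  let ?t = "Transposition.transpose i j" and ?u = "Transposition.transpose j k"
  note closed = G.mprod_closed g3_gen_closed
  have perm: "?t permutes {1..n}" "?u permutes {1..n}"
    using assms unfolding j_def k_def by (intro transpose_permutes; simp)+
  have ijk: "i \<in> {1..n}" "j \<in> {1..n}" "k \<in> {1..n}" "i \<noteq> j" "i \<noteq> k" "j \<noteq> k"
    using assms by (auto simp: j_def k_def)
  \<comment> \<open>One list in one order serves both words, because k comes last in the descent
    around i and i comes first in the descent around j.\<close>
  define ms where "ms = rev [1..<i] @ rev [Suc k..<n + 1]"
  have "[i + 2..<n + 1] = k # [Suc k..<n + 1]"
    using assms by (simp add: upt_conv_Cons j_def k_def del: upt_Suc)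
  then have listi: "rev [1..<i] @ rev [i + 2..<n + 1] = ms @ [k]"
    by (simp add: ms_def del: upt_Suc)
  have listj: "rev [1..<j] @ rev [j + 2..<n + 1] = i # ms"
    using assms by (simp add: ms_def j_def k_def)
  have ms: "m \<in> {1..n} \<and> m \<noteq> i \<and> m \<noteq> j \<and> m \<noteq> k" if "m \<in> set ms" for m
    using that assms by (auto simp: ms_def j_def k_def)
  have distinct: "distinct ms" by (auto simp: ms_def j_def k_def)
  define f where "f p q = G.mprod (\<lambda>m. ?a m p q) ms" for p q
  have f_closed: "f p q \<in> carrier ?G" if "p \<in> {i, j, k}" "q \<in> {i, j, k}" "p \<noteq> q" for p q
    unfolding f_def using that ms ijk by (auto intro!: closed simp: triples_iff)
  have a_closed: "?a p q r \<in> carrier ?G" if "(p, q, r) \<in> triples n" for p q r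
    using that by (rule g3_gen_closed)
  have \<omega>i: "phi_gen n i = (?t, f j i \<otimes>\<^bsub>?G\<^esub> ?a k j i)"
    unfolding phi_gen_eq listi f_def j_def[symmetric] using ms ijk a_closed[of k j i]
    by (subst G.mprod_append) (auto intro!: closed simp: triples_iff)
  have \<omega>j: "phi_gen n j = (?u, ?a i k j \<otimes>\<^bsub>?G\<^esub> f k j)"
    unfolding phi_gen_eq listj f_def k_def[symmetric] by simp
  have act_f: "g3_act n \<tau> (f p q) = f (\<tau> p) (\<tau> q)"
    if "\<tau> permutes {1..n}" "\<And>m. m \<notin> {i, j, k} \<Longrightarrow> \<tau> m = m"
      "p \<in> {i, j, k}" "q \<in> {i, j, k}" "p \<noteq> q" for \<tau> p q
    unfolding f_def
  proof (subst g3_act_mprod[OF that(1)])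
    show "G.mprod (\<lambda>m. ?a (\<tau> m) (\<tau> p) (\<tau> q)) ms = G.mprod (\<lambda>m. ?a m (\<tau> p) (\<tau> q)) ms"
      using that(2) ms by (intro G.mprod_cong) simp
  qed (use that(3-) ms ijk in \<open>auto simp: triples_iff\<close>)
  have act_mult: "g3_act n \<tau> (x \<otimes>\<^bsub>?G\<^esub> y) = g3_act n \<tau> x \<otimes>\<^bsub>?G\<^esub> g3_act n \<tau> y"
    if "\<tau> permutes {1..n}" "x \<in> carrier ?G" "y \<in> carrier ?G" for \<tau> x y
    using that by (simp add: group_hom.hom_mult[OF group_hom_g3_act])
  have ut: "?u \<circ> ?t permutes {1..n}" "?t \<circ> ?u permutes {1..n}"
    using perm by (auto intro: permutes_compose)
  \<comment> \<open>The permutation \<open>?t \<circ> ?u\<close> is the cycle i to j to k to i, and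
    \<open>?u \<circ> ?t\<close> is its inverse.\<close>
  have act_fs: "g3_act n (?t \<circ> ?u) (f j i) = f k j" "g3_act n (?u \<circ> ?t) (f k j) = f j i"
    "g3_act n ?t (f k j) = f k i" "g3_act n ?u (f j i) = f k i"
    using ijk perm ut by (subst act_f; simp add: Transposition.transpose_def)+
  have acts: "g3_act n (?t \<circ> ?u) (f j i \<otimes>\<^bsub>?G\<^esub> ?a k j i) = f k j \<otimes>\<^bsub>?G\<^esub> ?a i k j"
    "g3_act n (?u \<circ> ?t) (?a i k j \<otimes>\<^bsub>?G\<^esub> f k j) = ?a k j i \<otimes>\<^bsub>?G\<^esub> f j i"
    "g3_act n ?t (?a i k j \<otimes>\<^bsub>?G\<^esub> f k j) = ?a j k i \<otimes>\<^bsub>?G\<^esub> f k i"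
    "g3_act n ?u (f j i \<otimes>\<^bsub>?G\<^esub> ?a k j i) = f k i \<otimes>\<^bsub>?G\<^esub> ?a j k i"
    using ijk perm ut f_closed a_closed
    by (simp_all add: act_mult act_fs g3_act_gen triples_iff Transposition.transpose_def)
  have cl: "f k j \<in> carrier ?G" "f k i \<in> carrier ?G" "f j i \<in> carrier ?G" "?a k j i \<in> carrier ?G"
    "?a i k j \<in> carrier ?G" "?a j k i \<in> carrier ?G"
    using ijk f_closed a_closed by (simp_all add: triples_iff)
  have inv: "?a j k i = inv\<^bsub>?G\<^esub> ?a i k j"
    using ijk by (intro g3_inv) (simp add: triples_iff)
  have hexagon: "f k j \<otimes>\<^bsub>?G\<^esub> (f k i \<otimes>\<^bsub>?G\<^esub> (f j i \<otimes>\<^bsub>?G\<^esub> ?a k j i)) =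
      ?a k j i \<otimes>\<^bsub>?G\<^esub> (f j i \<otimes>\<^bsub>?G\<^esub> (f k i \<otimes>\<^bsub>?G\<^esub> f k j))"
    unfolding f_def
  proof (rule G.mprod_hexagon[OF cl(4) _ _ _ distinct])
    fix m assume m: "m \<in> set ms"
    show "?a m k j \<in> carrier ?G \<and> ?a m k i \<in> carrier ?G \<and> ?a m j i \<in> carrier ?G"
      using ms[OF m] ijk by (simp add: a_closed triples_iff)
    show "?a m k j \<otimes>\<^bsub>?G\<^esub> (?a m k i \<otimes>\<^bsub>?G\<^esub> (?a m j i \<otimes>\<^bsub>?G\<^esub> ?a k j i)) =
        ?a k j i \<otimes>\<^bsub>?G\<^esub> (?a m j i \<otimes>\<^bsub>?G\<^esub> (?a m k i \<otimes>\<^bsub>?G\<^esub> ?a m k j))"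
      using ms[OF m] ijk by (intro g3_tetrahedron) auto
    fix m' assume m': "m' \<in> set ms" "m \<noteq> m'"
    have dist: "distinct [m, m', i, j, k]" using ms[OF m] ms[OF m'(1)] m'(2) ijk by auto
    have trips: "(m, p, q) \<in> triples n" "(m', p, q) \<in> triples n"
      if "p \<in> {i, j, k}" "q \<in> {i, j, k}" "p \<noteq> q" for p q
      using that ms[OF m] ms[OF m'(1)] ijk by (auto simp: triples_iff)
    show "?a m k j \<otimes>\<^bsub>?G\<^esub> ?a m' k i = ?a m' k i \<otimes>\<^bsub>?G\<^esub> ?a m k j \<and>
        ?a m k j \<otimes>\<^bsub>?G\<^esub> ?a m' j i = ?a m' j i \<otimes>\<^bsub>?G\<^esub> ?a m k j \<and>
        ?a m k i \<otimes>\<^bsub>?G\<^esub> ?a m' j i = ?a m' j i \<otimes>\<^bsub>?G\<^esub> ?a m k i"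
      using ijk by (intro conjI g3_commute_distinct[OF _ _ dist] trips) auto
  qed
  have "f k j \<otimes>\<^bsub>?G\<^esub> ?a i k j \<otimes>\<^bsub>?G\<^esub> (?a j k i \<otimes>\<^bsub>?G\<^esub> f k i \<otimes>\<^bsub>?G\<^esub> (f j i \<otimes>\<^bsub>?G\<^esub> ?a k j i)) =
      f k j \<otimes>\<^bsub>?G\<^esub> (f k i \<otimes>\<^bsub>?G\<^esub> (f j i \<otimes>\<^bsub>?G\<^esub> ?a k j i))"
  proof -
    have "?a i k j \<otimes>\<^bsub>?G\<^esub> (?a j k i \<otimes>\<^bsub>?G\<^esub> z) = z" if "z \<in> carrier ?G" for z
      using that cl by (simp add: inv flip: G.m_assoc)
    then show ?thesis using cl by (simp add: G.m_assoc)
  qed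
  also note hexagon
  also have "?a k j i \<otimes>\<^bsub>?G\<^esub> (f j i \<otimes>\<^bsub>?G\<^esub> (f k i \<otimes>\<^bsub>?G\<^esub> f k j)) =
      ?a k j i \<otimes>\<^bsub>?G\<^esub> f j i \<otimes>\<^bsub>?G\<^esub> (f k i \<otimes>\<^bsub>?G\<^esub> ?a j k i \<otimes>\<^bsub>?G\<^esub> (?a i k j \<otimes>\<^bsub>?G\<^esub> f k j))"
  proof -
    have "?a j k i \<otimes>\<^bsub>?G\<^esub> (?a i k j \<otimes>\<^bsub>?G\<^esub> z) = z" if "z \<in> carrier ?G" for z
      using that cl by (simp add: inv flip: G.m_assoc)
    then show ?thesis using cl by (simp add: G.m_assoc)
  qed
  finally have main: "f k j \<otimes>\<^bsub>?G\<^esub> ?a i k j \<otimes>\<^bsub>?G\<^esub> (?a j k i \<otimes>\<^bsub>?G\<^esub> f k i \<otimes>\<^bsub>?G\<^esub> (f j i \<otimes>\<^bsub>?G\<^esub> ?a k j i)) =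
      ?a k j i \<otimes>\<^bsub>?G\<^esub> f j i \<otimes>\<^bsub>?G\<^esub> (f k i \<otimes>\<^bsub>?G\<^esub> ?a j k i \<otimes>\<^bsub>?G\<^esub> (?a i k j \<otimes>\<^bsub>?G\<^esub> f k j))" .
  have "?t \<circ> ?u \<circ> ?t = ?u \<circ> ?t \<circ> ?u"
    using ijk by (auto simp: fun_eq_iff Transposition.transpose_def)
  then show ?thesis
    using main unfolding j_def[symmetric, unfolded Suc_eq_plus1]
    by (simp add: \<omega>i \<omega>j perm_g3_group_def acts)
qed

lemma satisfies_phi_gen:
  "group.satisfies (perm_g3_group n) (phi_gen n) {1..<n} (braid_rels n)"
proof -
  interpret group "perm_g3_group n" by simp
  have closed: "phi_gen n i \<in> carrier (perm_g3_group n)" if "i \<in> {1..<n}" for i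
    using that phi_gen_closed by simp
  have "eval_word (perm_g3_group n) (phi_gen n) l = eval_word (perm_g3_group n) (phi_gen n) r"
    if lr: "(l, r) \<in> braid_rels n" for l r
  proof -
    consider (far) i j where "l = [(i, True), (j, True)]" "r = [(j, True), (i, True)]"
        "i \<in> {1..<n}" "j \<in> {1..<n}" "i + 1 < j \<or> j + 1 < i"
      | (braid) i where "l = [(i, True), (i + 1, True), (i, True)]"
        "r = [(i + 1, True), (i, True), (i + 1, True)]" "1 \<le> i" "i + 2 \<le> n"
      using lr unfolding braid_rels_def
      by (elim UnE CollectE exE conjE Pair_inject) (rule that; assumption)+
    then show ?thesis
    proof cases
      case far
      have "phi_gen n i \<otimes>\<^bsub>perm_g3_group n\<^esub> phi_gen n j = phi_gen n j \<otimes>\<^bsub>perm_g3_group n\<^esub> phi_gen n i"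
        using far(3-5) phi_gen_far[of i j n] phi_gen_far[of j i n] by auto
      then show ?thesis using closed[OF far(3)] closed[OF far(4)] by (simp add: far(1,2))
    next
      case braid
      then have "phi_gen n i \<in> carrier (perm_g3_group n)"
        "phi_gen n (i + 1) \<in> carrier (perm_g3_group n)"
        by (auto intro: phi_gen_closed)
      then show ?thesis using phi_gen_braid[OF braid(3,4)] by (simp add: braid(1,2))
    qed
  qed
  with closed show ?thesis unfolding satisfies_def by blast
qed

section \<open>The free module\<close>

lemma lpow_mult: "lpow x a * lpow x b = lpow x (a + b)"
  by (simp add: lpow_def mult_single single_add)

lemma lpow_zero: "lpow x 0 = 1"
  by (simp add: lpow_def)

text \<open>Sorting a product can leave a variable and its inverse followed or separated by another
  factor \<open>a\<close>; the longer forms catch these positions.\<close>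

lemma lpow_cancel [simp]:
  "lpow x 1 * lpow x (- 1) = 1" "lpow x (- 1) * lpow x 1 = 1"
  "lpow x 1 * (lpow x (- 1) * a) = a" "lpow x (- 1) * (lpow x 1 * a) = a"
  "lpow x 1 * (a * lpow x (- 1)) = a" "lpow x (- 1) * (a * lpow x 1) = a"
proof -
  show eq: "lpow x 1 * lpow x (- 1) = 1" "lpow x (- 1) * lpow x 1 = 1"
    by (simp_all add: lpow_mult lpow_zero)
  show "lpow x 1 * (lpow x (- 1) * a) = a" "lpow x (- 1) * (lpow x 1 * a) = a"
    by (simp_all add: eq flip: mult.assoc)
  show "lpow x 1 * (a * lpow x (- 1)) = a" "lpow x (- 1) * (a * lpow x 1) = a"
    by (simp_all add: eq mult.left_commute)
qed

lemma laurent_ring_simps [simp]: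
  "p \<otimes>\<^bsub>laurent_ring n\<^esub> q = p * q" "p \<oplus>\<^bsub>laurent_ring n\<^esub> q = p + q"
  "\<one>\<^bsub>laurent_ring n\<^esub> = 1" "\<zero>\<^bsub>laurent_ring n\<^esub> = 0"
  by (simp_all add: laurent_ring_def)

lemma laurent_closed:
  shows laurent_zero_closed: "0 \<in> carrier (laurent_ring n)"
    and laurent_one_closed: "1 \<in> carrier (laurent_ring n)"
    and laurent_add_closed: "p \<in> carrier (laurent_ring n) \<Longrightarrow> q \<in> carrier (laurent_ring n) \<Longrightarrow>
      p + q \<in> carrier (laurent_ring n)"
    and laurent_mult_closed: "p \<in> carrier (laurent_ring n) \<Longrightarrow> q \<in> carrier (laurent_ring n) \<Longrightarrow>
      p * q \<in> carrier (laurent_ring n)"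
    and laurent_uminus_closed: "p \<in> carrier (laurent_ring n) \<Longrightarrow> - p \<in> carrier (laurent_ring n)"
proof -
  show "0 \<in> carrier (laurent_ring n)" "1 \<in> carrier (laurent_ring n)"
    by (simp_all add: laurent_ring_def)
  show "p \<in> carrier (laurent_ring n) \<Longrightarrow> - p \<in> carrier (laurent_ring n)"
    by (simp add: laurent_ring_def)
  show "p + q \<in> carrier (laurent_ring n)"
    if "p \<in> carrier (laurent_ring n)" "q \<in> carrier (laurent_ring n)"
    using that Poly_Mapping.keys_add[of p q] unfolding laurent_ring_def by (simp add: subset_iff) blast
  show "p * q \<in> carrier (laurent_ring n)"
    if "p \<in> carrier (laurent_ring n)" "q \<in> carrier (laurent_ring n)"
  proof -
    have "Poly_Mapping.keys m \<subseteq> T ` {1..n} \<union> S ` {1..n}" if m: "m \<in> Poly_Mapping.keys (p * q)" for m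
    proof -
      obtain a b where ab: "a \<in> Poly_Mapping.keys p" "b \<in> Poly_Mapping.keys q" "m = a + b"
        using m keys_mult[of p q] by blast
      have "Poly_Mapping.keys a \<subseteq> T ` {1..n} \<union> S ` {1..n}" "Poly_Mapping.keys b \<subseteq> T ` {1..n} \<union> S ` {1..n}"
        using \<open>p \<in> carrier (laurent_ring n)\<close> \<open>q \<in> carrier (laurent_ring n)\<close> ab(1,2)
        by (simp_all add: laurent_ring_def)
      then show ?thesis
        unfolding ab(3) using Poly_Mapping.keys_add[of a b] by blast
    qed
    then show ?thesis by (simp add: laurent_ring_def)
  qed
qed

lemma laurent_diff_closed:
  "p \<in> carrier (laurent_ring n) \<Longrightarrow> q \<in> carrier (laurent_ring n) \<Longrightarrow> p - q \<in> carrier (laurent_ring n)"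
  using laurent_add_closed[of p n "- q"] laurent_uminus_closed[of q n] by simp

lemma lpow_closed: "i \<in> {1..n} \<Longrightarrow> lpow (T i) e \<in> carrier (laurent_ring n)"
    "i \<in> {1..n} \<Longrightarrow> lpow (S i) e \<in> carrier (laurent_ring n)"
  by (auto simp: lpow_def laurent_ring_def)

lemma cring_laurent_ring: "cring (laurent_ring n)"
proof (rule cringI)
  show "abelian_group (laurent_ring n)"
  proof (rule abelian_groupI)
    fix p assume "p \<in> carrier (laurent_ring n)"
    then show "\<exists>q\<in>carrier (laurent_ring n). q \<oplus>\<^bsub>laurent_ring n\<^esub> p = \<zero>\<^bsub>laurent_ring n\<^esub>"
      by (intro bexI[of _ "- p"]) (simp_all add: laurent_uminus_closed)
  qed (simp_all add: laurent_closed ac_simps)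
  show "comm_monoid (laurent_ring n)"
    by (rule comm_monoidI) (simp_all add: laurent_closed ac_simps)
qed (simp add: distrib_right)

section \<open>Coordinates, finite sums and the standard basis of the free module\<close>

lemma free_mod_simps [simp]:
  "v \<oplus>\<^bsub>free_mod n\<^esub> w = (\<lambda>b. v b + w b)" "\<zero>\<^bsub>free_mod n\<^esub> = (\<lambda>b. 0)"
  "a \<odot>\<^bsub>free_mod n\<^esub> v = (\<lambda>b. a * v b)"
  by (simp_all add: free_mod_def)

text \<open>Coordinates outside \<open>pairs n\<close> are 0, which lies in the ring, so ring
  membership can be demanded at every index and closure proofs avoid a case distinction.\<close>

lemma free_mod_carrier:
  "v \<in> carrier (free_mod n) \<longleftrightarrow>
    (\<forall>b. v b \<in> carrier (laurent_ring n)) \<and> (\<forall>b. b \<notin> pairs n \<longrightarrow> v b = 0)"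
  using laurent_zero_closed[of n] by (auto simp: free_mod_def)

lemma free_mod_coord:
  "v \<in> carrier (free_mod n) \<Longrightarrow> v b \<in> carrier (laurent_ring n)"
  "v \<in> carrier (free_mod n) \<Longrightarrow> b \<notin> pairs n \<Longrightarrow> v b = 0"
  unfolding free_mod_carrier by blast+

lemma abelian_group_free_mod: "abelian_group (free_mod n)"
proof (rule abelian_groupI)
  fix v assume "v \<in> carrier (free_mod n)"
  then show "\<exists>w\<in>carrier (free_mod n). w \<oplus>\<^bsub>free_mod n\<^esub> v = \<zero>\<^bsub>free_mod n\<^esub>"
    by (intro bexI[of _ "\<lambda>b. - v b"]) (simp_all add: free_mod_carrier laurent_uminus_closed)
qed (simp_all add: free_mod_carrier laurent_closed ac_simps)

lemma module_free_mod: "module (laurent_ring n) (free_mod n)"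
  by (rule moduleI[OF cring_laurent_ring abelian_group_free_mod])
    (simp_all add: free_mod_carrier laurent_closed algebra_simps)

lemma finsum_free_mod:
  assumes "finite I" "\<And>i. i \<in> I \<Longrightarrow> f i \<in> carrier (free_mod n)"
  shows "(\<Oplus>\<^bsub>free_mod n\<^esub>i\<in>I. f i) = (\<lambda>b. \<Sum>i\<in>I. f i b)"
proof -
  interpret abelian_group "free_mod n" by (rule abelian_group_free_mod)
  show ?thesis
    using assms by (induction I) (auto simp: Pi_def)
qed

lemma finite_pairs: "finite (pairs n)"
  by (rule finite_subset[of _ "{1..n} \<times> {1..n}"]) (auto simp: pairs_def)

lemma basis_vec_closed: "b \<in> pairs n \<Longrightarrow> basis_vec b \<in> carrier (free_mod n)"
  by (auto simp: free_mod_carrier basis_vec_def laurent_closed)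

lemma smult_closed_free_mod:
  "a \<in> carrier (laurent_ring n) \<Longrightarrow> v \<in> carrier (free_mod n) \<Longrightarrow> (\<lambda>b. a * v b) \<in> carrier (free_mod n)"
  by (simp add: free_mod_carrier laurent_mult_closed)

lemma linear_combination_basis_vec:
  assumes "c \<in> pairs n \<rightarrow> carrier (laurent_ring n)"
  shows "(\<Oplus>\<^bsub>free_mod n\<^esub>i\<in>pairs n. c i \<odot>\<^bsub>free_mod n\<^esub> basis_vec i) =
    (\<lambda>b. if b \<in> pairs n then c b else 0)"
proof (subst finsum_free_mod[OF finite_pairs])
  show "(\<lambda>b. \<Sum>i\<in>pairs n. (c i \<odot>\<^bsub>free_mod n\<^esub> basis_vec i) b) = (\<lambda>b. if b \<in> pairs n then c b else 0)"
    using finite_pairs by (auto simp: basis_vec_def if_distrib[of "\<lambda>x. _ * x"] cong: if_cong)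
qed (use assms in \<open>auto intro!: smult_closed_free_mod basis_vec_closed\<close>)

text \<open>The coefficients are the coordinates, cut off to \<open>pairs n\<close> because
  \<open>finite_basis\<close> asks for uniqueness among extensional families.\<close>

lemma finite_basis_free_mod: "finite_basis (laurent_ring n) (free_mod n) basis_vec (pairs n)"
  unfolding finite_basis_def
proof (intro conjI ballI ex1I)
  fix v assume v: "v \<in> carrier (free_mod n)"
  show "restrict v (pairs n) \<in> pairs n \<rightarrow>\<^sub>E carrier (laurent_ring n)"
    using v by (auto simp: free_mod_carrier)
  have "restrict v (pairs n) \<in> pairs n \<rightarrow> carrier (laurent_ring n)"
    using v by (auto simp: free_mod_carrier)
  from linear_combination_basis_vec[OF this]
  show "v = (\<Oplus>\<^bsub>free_mod n\<^esub>i\<in>pairs n. restrict v (pairs n) i \<odot>\<^bsub>free_mod n\<^esub> basis_vec i)"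
    using v by (auto simp: free_mod_carrier fun_eq_iff)
  fix c assume c: "c \<in> pairs n \<rightarrow>\<^sub>E carrier (laurent_ring n) \<and>
    v = (\<Oplus>\<^bsub>free_mod n\<^esub>i\<in>pairs n. c i \<odot>\<^bsub>free_mod n\<^esub> basis_vec i)"
  then have c': "c \<in> pairs n \<rightarrow>\<^sub>E carrier (laurent_ring n)" by blast
  then have "c \<in> pairs n \<rightarrow> carrier (laurent_ring n)" by auto
  with c have v': "v = (\<lambda>b. if b \<in> pairs n then c b else 0)"
    by (simp only: linear_combination_basis_vec)
  show "c = restrict v (pairs n)"
    unfolding v' using PiE_arb[OF c'] by (auto simp: fun_eq_iff)
qed (auto intro: finite_pairs basis_vec_closed)

section \<open>The monoid of endomorphisms of a module\<close>

lemma End_monoid_simps [simp]: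
  "carrier (End_monoid R M) = module_endos R M"
  "f \<otimes>\<^bsub>End_monoid R M\<^esub> g = compose (carrier M) f g"
  "\<one>\<^bsub>End_monoid R M\<^esub> = (\<lambda>v\<in>carrier M. v)"
  by (simp_all add: End_monoid_def)

lemma monoid_End_monoid:
  assumes "module R M"
  shows "monoid (End_monoid R M)"
proof -
  interpret module R M by fact
  show ?thesis
  proof (rule monoidI)
    fix f g assume "f \<in> carrier (End_monoid R M)" "g \<in> carrier (End_monoid R M)"
    then show "f \<otimes>\<^bsub>End_monoid R M\<^esub> g \<in> carrier (End_monoid R M)"
      by (auto simp: module_endos_def compose_def PiE_iff)
  next
    fix f g h assume "f \<in> carrier (End_monoid R M)" "g \<in> carrier (End_monoid R M)"
      "h \<in> carrier (End_monoid R M)"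
    then show "f \<otimes>\<^bsub>End_monoid R M\<^esub> g \<otimes>\<^bsub>End_monoid R M\<^esub> h =
        f \<otimes>\<^bsub>End_monoid R M\<^esub> (g \<otimes>\<^bsub>End_monoid R M\<^esub> h)"
      by (auto simp: module_endos_def compose_def PiE_iff fun_eq_iff)
  qed (auto simp: module_endos_def compose_def PiE_iff fun_eq_iff extensional_def)
qed

section \<open>The representation on the free module\<close>

text \<open>The action on basis vectors, transposed to coordinates: position \<open>(i, k)\<close>
  also receives the part coming from \<open>(i, j)\<close>, and \<open>(k, i)\<close> the part
  coming from \<open>(k, j)\<close>. Relations thereby become pointwise identities without
  sums.\<close>

definition rho_fun :: "nat \<Rightarrow> nat \<Rightarrow> nat \<Rightarrow> (nat \<times> nat \<Rightarrow> laurent) \<Rightarrow> nat \<times> nat \<Rightarrow> laurent"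
  where "rho_fun i j k v = (\<lambda>c.
    if c = (i, j) then lpow (T i) 1 * v (i, j)
    else if c = (i, k) then v (i, k) + (1 - lpow (T i) 1) * v (i, j)
    else if c = (k, j) then lpow (T k) (- 1) * v (k, j)
    else if c = (k, i) then v (k, i) + (1 - lpow (T k) (- 1)) * v (k, j)
    else if c = (j, k) then lpow (S j) 1 * v (j, k)
    else if c = (j, i) then lpow (S j) (- 1) * v (j, i)
    else v c)"

lemma triples_pairs:
  assumes "(i, j, k) \<in> triples n"
  shows "i \<in> {1..n}" "j \<in> {1..n}" "k \<in> {1..n}" "i \<noteq> j" "i \<noteq> k" "j \<noteq> k"
    "(i, j) \<in> pairs n" "(i, k) \<in> pairs n" "(k, j) \<in> pairs n" "(k, i) \<in> pairs n" "(j, k) \<in> pairs n"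
    "(j, i) \<in> pairs n"
  using assms by (auto simp: triples_def pairs_def)

text \<open>The matrix entry as a diagonal part plus two off-diagonal indicators. Each part meets at
  most one summand of the sum over \<open>b\<close>, which then collapses by
  \<open>sum.delta\<close>.\<close>

lemma rho_basis_apply:
  assumes "distinct [i, j, k]"
  shows "rho_basis n i j k b c =
    (if b = c then
      (if b = (i, j) then lpow (T i) 1 else if b = (k, j) then lpow (T k) (- 1)
       else if b = (j, k) then lpow (S j) 1 else if b = (j, i) then lpow (S j) (- 1) else 1) else 0) +
    (if b = (i, j) then (if c = (i, k) then 1 - lpow (T i) 1 else 0) else 0) +
    (if b = (k, j) then (if c = (k, i) then 1 - lpow (T k) (- 1) else 0) else 0)"
  using assms by (auto simp: rho_basis_def basis_vec_def)

lemma rho_basis_closed: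
  assumes "(i, j, k) \<in> triples n" "b \<in> pairs n"
  shows "rho_basis n i j k b \<in> carrier (free_mod n)"
proof -
  interpret module "laurent_ring n" "free_mod n" by (rule module_free_mod)
  show ?thesis
    unfolding rho_basis_def using triples_pairs[OF assms(1)] assms(2)
    by (simp del: free_mod_simps add: smult_closed basis_vec_closed lpow_closed laurent_diff_closed laurent_closed)
qed

lemma rho_gen_sum:
  assumes "(i, j, k) \<in> triples n" "v \<in> carrier (free_mod n)"
  shows "rho_gen n i j k v = (\<lambda>c. \<Sum>b\<in>pairs n. v b * rho_basis n i j k b c)"
proof -
  have "(\<lambda>c. v b * rho_basis n i j k b c) \<in> carrier (free_mod n)" if "b \<in> pairs n" for b
    using free_mod_coord(1)[OF assms(2)] rho_basis_closed[OF assms(1) that]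
    by (rule smult_closed_free_mod)
  then show ?thesis
    using assms(2) by (simp add: rho_gen_def finsum_free_mod finite_pairs)
qed

lemma rho_gen_eq:
  assumes "(i, j, k) \<in> triples n" "v \<in> carrier (free_mod n)"
  shows "rho_gen n i j k v = rho_fun i j k v"
proof -
  note ijk = triples_pairs[OF assms(1)]
  let ?d = "\<lambda>b. if b = (i, j) then lpow (T i) 1 else if b = (k, j) then lpow (T k) (- 1)
    else if b = (j, k) then lpow (S j) 1 else if b = (j, i) then lpow (S j) (- 1) else 1"
  have "(\<Sum>b\<in>pairs n. v b * rho_basis n i j k b c) = rho_fun i j k v c" for c
  proof -
    have "(\<Sum>b\<in>pairs n. v b * rho_basis n i j k b c) =
        (\<Sum>b\<in>pairs n. (if b = c then v c * ?d c else 0) +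
          (if b = (i, j) then v (i, j) * (if c = (i, k) then 1 - lpow (T i) 1 else 0) else 0) +
          (if b = (k, j) then v (k, j) * (if c = (k, i) then 1 - lpow (T k) (- 1) else 0) else 0))"
      using ijk(4-6) by (intro sum.cong) (auto simp: rho_basis_apply algebra_simps)
    also have "\<dots> = (if c \<in> pairs n then v c * ?d c else 0) +
        v (i, j) * (if c = (i, k) then 1 - lpow (T i) 1 else 0) +
        v (k, j) * (if c = (k, i) then 1 - lpow (T k) (- 1) else 0)"
      using ijk finite_pairs[of n] by (simp only: sum.distrib sum.delta if_True)
    also have "\<dots> = rho_fun i j k v c"
    proof (cases "c \<in> pairs n")
      case True
      then show ?thesis using ijk(4-6) by (auto simp: rho_fun_def mult.commute)
    next
      \<comment> \<open>The diagonal part contributes 0 here, which agrees with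
        \<open>rho_fun\<close> because \<open>v\<close> vanishes off \<open>pairs n\<close>.\<close>
      case False
      then have "c \<notin> {(i, j), (i, k), (k, j), (k, i), (j, k), (j, i)}" "v c = 0"
        using ijk free_mod_coord(2)[OF assms(2)] by auto
      then show ?thesis using False by (simp add: rho_fun_def)
    qed
    finally show ?thesis .
  qed
  then show ?thesis by (simp add: rho_gen_sum[OF assms])
qed

lemma rho_gen_basis_vec:
  assumes "(i, j, k) \<in> triples n" "b \<in> pairs n"
  shows "rho_gen n i j k (basis_vec b) = rho_basis n i j k b"
proof -
  have "(\<Sum>b'\<in>pairs n. basis_vec b b' * rho_basis n i j k b' c) =
      (\<Sum>b'\<in>pairs n. if b' = b then rho_basis n i j k b' c else 0)" for c
    by (intro sum.cong) (auto simp: basis_vec_def)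
  then show ?thesis
    using assms(2) finite_pairs[of n]
    by (simp add: rho_gen_sum[OF assms(1) basis_vec_closed[OF assms(2)]])
qed

lemma rho_fun_closed:
  assumes "(i, j, k) \<in> triples n" "v \<in> carrier (free_mod n)"
  shows "rho_fun i j k v \<in> carrier (free_mod n)"
  using assms(2) triples_pairs[OF assms(1)]
  by (auto simp: free_mod_carrier rho_fun_def lpow_closed laurent_closed laurent_diff_closed)

text \<open>The pairs \<open>x_ij\<close>, \<open>x_ik\<close> and \<open>x_kj\<close>,
  \<open>x_ki\<close> span triangular blocks of the form x to t x + (1 - t) y with y fixed, and such
  a block is inverted by replacing t with its inverse. Exchanging i and k does this in both blocks
  and inverts the scalars on \<open>x_jk\<close> and \<open>x_ji\<close>.\<close>

lemma rho_fun_inverse: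
  assumes "distinct [i, j, k]"
  shows "rho_fun k j i (rho_fun i j k v) = v"
  using assms by (auto simp: rho_fun_def fun_eq_iff algebra_simps)

lemma rho_fun_outside:
  assumes "distinct [i, j, k]" "\<not> (a \<noteq> b \<and> {a, b} \<subseteq> {i, j, k})"
  shows "rho_fun i j k v (a, b) = v (a, b)"
  using assms by (auto simp: rho_fun_def)

text \<open>Locality: coordinates with both indices in \<open>{i, j, k}\<close> depend only on
  coordinates of that kind. With \<open>rho_fun_outside\<close> this reduces commutation to
  disjointness of the coordinates involved.\<close>

lemma rho_fun_inside:
  assumes "distinct [i, j, k]" "a \<noteq> b" "{a, b} \<subseteq> {i, j, k}"
    and "\<And>a b. a \<noteq> b \<Longrightarrow> {a, b} \<subseteq> {i, j, k} \<Longrightarrow> v (a, b) = w (a, b)"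
  shows "rho_fun i j k v (a, b) = rho_fun i j k w (a, b)"
proof -
  have "v (i, j) = w (i, j)" "v (i, k) = w (i, k)" "v (k, j) = w (k, j)" "v (k, i) = w (k, i)"
    "v (j, k) = w (j, k)" "v (j, i) = w (j, i)" "v (a, b) = w (a, b)"
    using assms by (auto intro!: assms(4))
  then show ?thesis by (simp add: rho_fun_def)
qed

text \<open>By inclusion and exclusion the two triples share at most 3 + 3 - 5 = 1 index, so no pair
  of distinct indices lies in both, and the two maps work on disjoint sets of coordinates.\<close>

lemma rho_fun_commute:
  assumes "distinct [i, j, k]" "distinct [p, q, r]" "card {i, j, k, p, q, r} \<ge> 5"
  shows "rho_fun i j k (rho_fun p q r v) = rho_fun p q r (rho_fun i j k v)"
proof (rule ext, clarify)
  fix a b :: nat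
  have disj: False if "a \<noteq> b" "{a, b} \<subseteq> {i, j, k}" "{a, b} \<subseteq> {p, q, r}" for a b
  proof -
    have "card {i, j, k} = 3" "card {p, q, r} = 3" using assms(1,2) by auto
    moreover have "card {a, b} \<le> card ({i, j, k} \<inter> {p, q, r})"
      using that by (intro card_mono) auto
    moreover have "{i, j, k} \<union> {p, q, r} = {i, j, k, p, q, r}" by auto
    ultimately show False
      using card_Un_Int[of "{i, j, k}" "{p, q, r}"] assms(3) that(1) by simp
  qed
  have outside_pqr: "rho_fun p q r w (a, b) = w (a, b)"
    if "a \<noteq> b" "{a, b} \<subseteq> {i, j, k}" for a b w
    by (rule rho_fun_outside[OF assms(2)]) (use disj[OF that] in blast)
  have outside_ijk: "rho_fun i j k w (a, b) = w (a, b)"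
    if "a \<noteq> b" "{a, b} \<subseteq> {p, q, r}" for a b w
    by (rule rho_fun_outside[OF assms(1)]) (use disj[OF that(1) _ that(2)] in blast)
  consider "a \<noteq> b" "{a, b} \<subseteq> {i, j, k}" | "a \<noteq> b" "{a, b} \<subseteq> {p, q, r}"
    | "\<not> (a \<noteq> b \<and> {a, b} \<subseteq> {i, j, k})" "\<not> (a \<noteq> b \<and> {a, b} \<subseteq> {p, q, r})"
    by blast
  then show "rho_fun i j k (rho_fun p q r v) (a, b) = rho_fun p q r (rho_fun i j k v) (a, b)"
  proof cases
    case 1
    show ?thesis
      unfolding outside_pqr[OF 1] by (rule rho_fun_inside[OF assms(1) 1]) (rule outside_pqr)
  next
    case 2
    show ?thesis
      unfolding outside_ijk[OF 2] by (rule rho_fun_inside[OF assms(2) 2, symmetric]) (rule outside_ijk)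
  next
    case 3
    show ?thesis
      by (simp only: rho_fun_outside[OF assms(1) 3(1)] rho_fun_outside[OF assms(2) 3(2)])
  qed
qed

text \<open>Only the twelve coordinates with both indices among i, j, k, l can change, and at each
  of them both sides are explicit expressions. That the scalar belongs to the middle index matters:
  \<open>x_jk\<close> and \<open>x_jl\<close>, which are mixed by the triple (j, k, l), are scaled
  by the same factor under (i, j, k) and (i, j, l).\<close>

lemma rho_fun_tetrahedron:
  assumes "distinct [i, j, k, l]"
  shows "rho_fun i j k (rho_fun i j l (rho_fun i k l (rho_fun j k l v))) =
    rho_fun j k l (rho_fun i k l (rho_fun i j l (rho_fun i j k v)))"
proof (rule ext)
  fix c
  \<comment> \<open>Both orientations are listed because comparisons of pairs produce either
    one.\<close>
  have ne: "i \<noteq> j" "i \<noteq> k" "i \<noteq> l" "j \<noteq> k" "j \<noteq> l" "k \<noteq> l"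
    "j \<noteq> i" "k \<noteq> i" "l \<noteq> i" "k \<noteq> j" "l \<noteq> j" "l \<noteq> k"
    using assms by auto
  consider "c = (i, j)" | "c = (i, k)" | "c = (i, l)" | "c = (j, i)" | "c = (j, k)" | "c = (j, l)"
    | "c = (k, i)" | "c = (k, j)" | "c = (k, l)" | "c = (l, i)" | "c = (l, j)" | "c = (l, k)"
    | "c \<notin> {(i, j), (i, k), (i, l), (j, i), (j, k), (j, l), (k, i), (k, j), (k, l), (l, i), (l, j), (l, k)}"
    by blast
  then show "rho_fun i j k (rho_fun i j l (rho_fun i k l (rho_fun j k l v))) c =
    rho_fun j k l (rho_fun i k l (rho_fun i j l (rho_fun i j k v))) c"
    by cases (simp_all add: rho_fun_def ne algebra_simps)
qed

lemma rho_gen_endo: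
  assumes "(i, j, k) \<in> triples n"
  shows "rho_gen n i j k \<in> module_endos (laurent_ring n) (free_mod n)"
proof -
  interpret module "laurent_ring n" "free_mod n" by (rule module_free_mod)
  have eq: "rho_gen n i j k v = rho_fun i j k v" if "v \<in> carrier (free_mod n)" for v
    using assms that by (rule rho_gen_eq)
  have ext: "rho_gen n i j k \<in> carrier (free_mod n) \<rightarrow>\<^sub>E carrier (free_mod n)"
  proof (rule PiE_I)
    fix v assume "v \<in> carrier (free_mod n)"
    then show "rho_gen n i j k v \<in> carrier (free_mod n)"
      by (simp add: eq rho_fun_closed[OF assms])
  qed (simp add: rho_gen_def)
  have add: "rho_gen n i j k (v \<oplus>\<^bsub>free_mod n\<^esub> w) = rho_gen n i j k v \<oplus>\<^bsub>free_mod n\<^esub> rho_gen n i j k w"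
    if v: "v \<in> carrier (free_mod n)" and w: "w \<in> carrier (free_mod n)" for v w
    unfolding eq[OF M.a_closed[OF v w]] eq[OF v] eq[OF w]
    by (simp add: rho_fun_def fun_eq_iff distrib_left)
  have smult: "rho_gen n i j k (a \<odot>\<^bsub>free_mod n\<^esub> v) = a \<odot>\<^bsub>free_mod n\<^esub> rho_gen n i j k v"
    if a: "a \<in> carrier (laurent_ring n)" and v: "v \<in> carrier (free_mod n)" for a v
    unfolding eq[OF smult_closed[OF a v]] eq[OF v]
    by (simp add: rho_fun_def fun_eq_iff distrib_left mult.left_commute)
  show ?thesis unfolding module_endos_def using ext add smult by blast
qed

lemma compose_rho_gen:
  assumes "(i, j, k) \<in> triples n" "g \<in> carrier (free_mod n) \<rightarrow> carrier (free_mod n)"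
  shows "compose (carrier (free_mod n)) (rho_gen n i j k) g =
    (\<lambda>v\<in>carrier (free_mod n). rho_fun i j k (g v))"
  unfolding compose_def
  by (rule restrict_ext, rule rho_gen_eq[OF assms(1)]) (use assms(2) in auto)

lemma rho_gen_restrict:
  "(i, j, k) \<in> triples n \<Longrightarrow> rho_gen n i j k = (\<lambda>v\<in>carrier (free_mod n). rho_fun i j k v)"
  using rho_gen_eq[of i j k n] by (auto simp: fun_eq_iff rho_gen_def)

lemma triples_distinct: "(i, j, k) \<in> triples n \<Longrightarrow> distinct [i, j, k]"
  by (simp add: triples_def)

lemma triples_rev: "(i, j, k) \<in> triples n \<Longrightarrow> (k, j, i) \<in> triples n"
  by (auto simp: triples_def)

lemma rho_gen_inverse:
  assumes "(i, j, k) \<in> triples n"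
  shows "compose (carrier (free_mod n)) (rho_gen n k j i) (rho_gen n i j k) =
    (\<lambda>v\<in>carrier (free_mod n). v)"
proof -
  have "rho_gen n i j k \<in> carrier (free_mod n) \<rightarrow> carrier (free_mod n)"
    using rho_gen_endo[OF assms] by (auto simp: module_endos_def)
  from compose_rho_gen[OF triples_rev[OF assms] this] show ?thesis
    by (auto simp: fun_eq_iff rho_gen_eq[OF assms] rho_fun_inverse[OF triples_distinct[OF assms]])
qed

text \<open>Endomorphisms form only a monoid; evaluating letters of negative sign takes place in its
  group of units.\<close>

abbreviation rho_units :: "nat \<Rightarrow> ((nat \<times> nat \<Rightarrow> laurent) \<Rightarrow> nat \<times> nat \<Rightarrow> laurent) monoid"
  where "rho_units n \<equiv> units_of (End_monoid (laurent_ring n) (free_mod n))"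

lemma group_rho_units: "group (rho_units n)"
  by (rule monoid.units_group[OF monoid_End_monoid[OF module_free_mod]])

text \<open>The reversed triple gives the inverse: one side comes from
  \<open>rho_gen_inverse\<close> for (i, j, k), the other from (k, j, i).\<close>

lemma rho_gen_unit:
  assumes "(i, j, k) \<in> triples n"
  shows "rho_gen n i j k \<in> carrier (rho_units n)"
  using rho_gen_endo[OF assms] rho_gen_endo[OF triples_rev[OF assms]]
    rho_gen_inverse[OF assms] rho_gen_inverse[OF triples_rev[OF assms]]
  by (auto simp: units_of_carrier Units_def)

lemma satisfies_rho_gen:
  "group.satisfies (rho_units n) (\<lambda>(i, j, k). rho_gen n i j k) (triples n) (g3_rels n)"
proof (rule satisfies_g3I[OF group_rho_units rho_gen_unit])
  let ?U = "rho_units n"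
  interpret group ?U by (rule group_rho_units)
  fix i j k assume ijk: "(i, j, k) \<in> triples n"
  show "rho_gen n k j i = inv\<^bsub>?U\<^esub> rho_gen n i j k"
  proof (rule inv_equality[symmetric])
    show "rho_gen n k j i \<otimes>\<^bsub>?U\<^esub> rho_gen n i j k = \<one>\<^bsub>?U\<^esub>"
      using rho_gen_inverse[OF ijk] by (simp add: units_of_mult units_of_one)
  qed (rule rho_gen_unit[OF ijk] rho_gen_unit[OF triples_rev[OF ijk]])+
next
  fix i j k p q r
  assume t: "(i, j, k) \<in> triples n" "(p, q, r) \<in> triples n" "5 \<le> card {i, j, k, p, q, r}"
  show "rho_gen n i j k \<otimes>\<^bsub>rho_units n\<^esub> rho_gen n p q r =
      rho_gen n p q r \<otimes>\<^bsub>rho_units n\<^esub> rho_gen n i j k"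
    \<comment> \<open>The congruence rule provides membership in the carrier under the restriction,
      so nested compositions turn into nested applications of \<open>rho_fun\<close>.\<close>
    by (simp add: units_of_mult rho_gen_restrict t(1,2) compose_def rho_fun_closed
        rho_fun_commute[OF triples_distinct[OF t(1)] triples_distinct[OF t(2)] t(3)]
        cong: restrict_cong)
next
  fix i j k l assume ijkl: "{i, j, k, l} \<subseteq> {1..n}" "distinct [i, j, k, l]"
  have t: "(i, j, k) \<in> triples n" "(i, j, l) \<in> triples n" "(i, k, l) \<in> triples n"
    "(j, k, l) \<in> triples n"
    using ijkl by (auto simp: triples_def)
  show "rho_gen n i j k \<otimes>\<^bsub>rho_units n\<^esub> (rho_gen n i j l \<otimes>\<^bsub>rho_units n\<^esub>
      (rho_gen n i k l \<otimes>\<^bsub>rho_units n\<^esub> rho_gen n j k l)) =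
    rho_gen n j k l \<otimes>\<^bsub>rho_units n\<^esub> (rho_gen n i k l \<otimes>\<^bsub>rho_units n\<^esub>
      (rho_gen n i j l \<otimes>\<^bsub>rho_units n\<^esub> rho_gen n i j k))"
    by (simp add: units_of_mult rho_gen_restrict t compose_def rho_fun_closed
        rho_fun_tetrahedron[OF ijkl(2)] cong: restrict_cong)
qed

lemma group_hom_rho: "group_hom (g3_group n) (rho_units n) (rho n)"
  unfolding rho_def g3_group_def
  by (rule group.group_hom_induced_map[OF group_rho_units satisfies_rho_gen])

lemma rho_g3_gen: "(i, j, k) \<in> triples n \<Longrightarrow> rho n (g3_gen n i j k) = rho_gen n i j k"
  using group.induced_map_pres_gen[OF group_rho_units satisfies_rho_gen, of "(i, j, k)" n]
  by (simp add: rho_def g3_gen_def)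

section \<open>The representation of the pure braid group\<close>

lemma group_braid_group: "group (braid_group n)"
  unfolding braid_group_def by (rule group_presented_group)

lemma group_hom_braid_perm: "group_hom (braid_group n) (perm_group n) (braid_perm n)"
  unfolding braid_perm_def braid_group_def
  by (rule group.group_hom_induced_map[OF group_perm_group satisfies_braid_perm])

lemma braid_perm_sigma:
  "i \<in> {1..<n} \<Longrightarrow> braid_perm n (sigma n i) = Transposition.transpose i (i + 1)"
  unfolding braid_perm_def sigma_def
  by (rule group.induced_map_pres_gen[OF group_perm_group satisfies_braid_perm])

lemma group_hom_phi: "group_hom (braid_group n) (perm_g3_group n) (phi n)"
  unfolding phi_def braid_group_def
  by (rule group.group_hom_induced_map[OF group_perm_g3_group satisfies_phi_gen])

lemma phi_sigma: "i \<in> {1..<n} \<Longrightarrow> phi n (sigma n i) = phi_gen n i"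
  unfolding phi_def sigma_def
  by (rule group.induced_map_pres_gen[OF group_perm_g3_group satisfies_phi_gen])

text \<open>Projection to the permutation is a homomorphism, so it is enough to compare
  transpositions on the generators. This is why pure braids are sent to elements with trivial first
  component.\<close>

lemma fst_phi:
  assumes "b \<in> carrier (braid_group n)"
  shows "fst (phi n b) = braid_perm n b"
proof (rule group_hom_pres_eqI[where A = "{1..<n}" and R = "braid_rels n"])
  have "group_hom (perm_g3_group n) (perm_group n) fst"
    using group_perm_g3_group unfolding perm_g3_group_def
    by (rule group_hom_fst_semidirect_product[OF group_perm_group])
  from group_hom_comp[OF group_hom_phi this]
  show "group_hom (presented_group {1..<n} (braid_rels n)) (perm_group n) (\<lambda>b. fst (phi n b))"
    by (simp add: braid_group_def)
  show "group_hom (presented_group {1..<n} (braid_rels n)) (perm_group n) (braid_perm n)"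
    using group_hom_braid_perm by (simp add: braid_group_def)
  fix i assume "i \<in> {1..<n}"
  then show "fst (phi n (pres_gen {1..<n} (braid_rels n) i)) =
      braid_perm n (pres_gen {1..<n} (braid_rels n) i)"
    using phi_sigma[of i n] braid_perm_sigma[of i n] by (simp add: sigma_def phi_gen_def)
qed (use assms in \<open>simp add: braid_group_def\<close>)

lemma pure_braid_group_simps:
  "carrier (pure_braid_group n) = {b \<in> carrier (braid_group n). braid_perm n b = id}"
  "b \<otimes>\<^bsub>pure_braid_group n\<^esub> c = b \<otimes>\<^bsub>braid_group n\<^esub> c"
  by (simp_all add: pure_braid_group_def kernel_def)

lemma group_pure_braid_group: "group (pure_braid_group n)"
  unfolding pure_braid_group_def
  by (intro subgroup.subgroup_is_group group_hom.subgroup_kernel group_hom_braid_perm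
      group_braid_group)

lemma phi_pure_braid:
  assumes "b \<in> carrier (pure_braid_group n)"
  shows "phi n b = (id, phi_pure n b)" "phi_pure n b \<in> carrier (g3_group n)"
proof -
  have b: "b \<in> carrier (braid_group n)" "braid_perm n b = id"
    using assms by (simp_all add: pure_braid_group_simps)
  show phi: "phi n b = (id, phi_pure n b)"
    using fst_phi[OF b(1)] b(2) by (simp add: phi_pure_def prod_eq_iff)
  have "phi n b \<in> carrier (perm_g3_group n)"
    using group_hom.hom_closed[OF group_hom_phi b(1)] .
  then show "phi_pure n b \<in> carrier (g3_group n)"
    by (simp add: phi perm_g3_group_def)
qed

text \<open>The second component is twisted by the action of the right factor's permutation; on pure
  braids that permutation is the identity and the twist disappears by
  \<open>g3_act_id\<close>.\<close>

lemma group_hom_phi_pure: "group_hom (pure_braid_group n) (g3_group n) (phi_pure n)"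
proof -
  interpret P: group "pure_braid_group n" by (rule group_pure_braid_group)
  have "phi_pure n \<in> hom (pure_braid_group n) (g3_group n)"
  proof (rule homI)
    fix b assume "b \<in> carrier (pure_braid_group n)"
    then show "phi_pure n b \<in> carrier (g3_group n)" by (rule phi_pure_braid)
  next
    fix b c assume b: "b \<in> carrier (pure_braid_group n)" and c: "c \<in> carrier (pure_braid_group n)"
    have "phi n (b \<otimes>\<^bsub>pure_braid_group n\<^esub> c) = phi n b \<otimes>\<^bsub>perm_g3_group n\<^esub> phi n c"
      using b c group_hom.hom_mult[OF group_hom_phi] by (simp add: pure_braid_group_simps)
    then show "phi_pure n (b \<otimes>\<^bsub>pure_braid_group n\<^esub> c) =
        phi_pure n b \<otimes>\<^bsub>g3_group n\<^esub> phi_pure n c"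
      unfolding phi_pure_braid(1)[OF b] phi_pure_braid(1)[OF c]
        phi_pure_braid(1)[OF P.m_closed[OF b c]]
      by (simp add: perm_g3_group_def g3_act_id phi_pure_braid(2)[OF b])
  qed
  then show ?thesis
    by (simp add: group_hom_def group_hom_axioms_def group_pure_braid_group)
qed

text \<open>Since \<open>induced_map\<close> is a total function, its mere name guarantees nothing.
  The earlier conjuncts certify that each map is the intended one, by the homomorphism property and
  the values on generators; the last one then is a composition of homomorphisms.\<close>

theorem corollary2:
  fixes n :: nat
  assumes "n \<ge> 1"
  shows
    "group_hom (braid_group n) (perm_group n) (braid_perm n) \<and>
     (\<forall>i\<in>{1..<n}. braid_perm n (sigma n i) = Transposition.transpose i (i + 1)) \<and>
     (\<forall>\<tau>\<in>carrier (perm_group n).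
        g3_act n \<tau> \<in> iso (g3_group n) (g3_group n) \<and>
        (\<forall>(i, j, k)\<in>triples n. g3_act n \<tau> (g3_gen n i j k) = g3_gen n (\<tau> i) (\<tau> j) (\<tau> k))) \<and>
     group_hom (braid_group n) (perm_g3_group n) (phi n) \<and>
     (\<forall>i\<in>{1..<n}. phi n (sigma n i) = phi_gen n i) \<and>
     (\<forall>b\<in>carrier (pure_braid_group n). phi n b \<in> {\<one>\<^bsub>perm_group n\<^esub>} \<times> carrier (g3_group n)) \<and>
     group_hom (pure_braid_group n) (g3_group n) (phi_pure n) \<and>
     finite_basis (laurent_ring n) (free_mod n) basis_vec (pairs n) \<and>
     representation (g3_group n) (laurent_ring n) (free_mod n) (rho n) \<and>
     (\<forall>(i, j, k)\<in>triples n.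
        rho n (g3_gen n i j k) = rho_gen n i j k \<and>
        (\<forall>b\<in>pairs n. rho_gen n i j k (basis_vec b) = rho_basis n i j k b)) \<and>
     representation (pure_braid_group n) (laurent_ring n) (free_mod n) (rho n \<circ> phi_pure n)"
  using group_hom_braid_perm[of n] braid_perm_sigma[of _ n] g3_act_iso[of _ n] g3_act_gen[of _ n]
    group_hom_phi[of n] phi_sigma[of _ n] phi_pure_braid[of _ n] group_hom_phi_pure[of n]
    finite_basis_free_mod[of n] group_hom_rho[of n] rho_g3_gen[of _ _ _ n]
    rho_gen_basis_vec[of _ _ _ n] module_free_mod[of n]
    group_hom_comp[OF group_hom_phi_pure[of n] group_hom_rho[of n]]
  by (auto simp: representation_def o_def simp del: One_nat_def)

end
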